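(* For $r$ a positive integer and $\rho$ a function on the positive integers, let $f_r(T)$ be the formal power series defined by $$f_r(T):=\sum_{\lambda\in\mathscr{P}} T^{|\lambda|}\prod_{h\in\mathscr{H}^{(b)}(\lambda)}\rho(rh).$$ Then $$\sum_{\lambda\in\mathscr{P}}T^{|\lambda|}S^{|\mathscr{H}_r(\lambda)|}\prod_{h\in\mathscr{H}^{(b)}_r(\lambda)}\rho(h)=\frac{(T^r;T^r)_\infty^r}{(T;T)_\infty\,(ST^r;ST^r)_\infty^{r-1}}\,f_r(ST^r).$$
   Context: $\mathscr{P}$ is the set of all integer partitions $\lambda=(\lambda_1,\lambda_2,\dots)$ (including the empty partition $0$), and $|\lambda|=\sum_i\lambda_i$. A partition is identified with its Young diagram $\{(i,j): 1\le j\le\lambda_i\}$; $\lambda'$ is the conjugate partition. For a square $s=(i,j)\in\lambda$: arm-length $a(s)=\lambda_i-j$, leg-length $l(s)=\lambda'_j-i$, hook-length $h(s)=a(s)+l(s)+1$. $\mathscr{H}_r(\lambda)$ is the multiset of all hook-lengths of squares of $\lambda$ that are congruent to $0$ modulo $r$, and $|\mathscr{H}_r(\lambda)|$ is its cardinality (with multiplicity). A bottom square is a square $s\in\lambda$ with $l(s)=0$. $\mathscr{H}^{(b)}_r(\lambda)$ is the multiset of hook-lengths of bottom squares of $\lambda$ that are congruent to $0$ modulo $r$, and $\mathscr{H}^{(b)}(\lambda):=\mathscr{H}^{(b)}_1(\lambda)$. $(a;q)_\infty=\prod_{j\ge0}(1-aq^j)$. Identities are in the sense of formal power series in $T$, with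 $S$ a further formal variable; $\rho$ takes values in a commutative ring with identity. Products over multisets are taken with multiplicity, and empty products are $1$. *)

theory Defs
  imports
    "HOL-Analysis.Analysis"
    "HOL-Computational_Algebra.Computational_Algebra"
    "HOL-Library.Multiset"
begin

text \<open>
  A partition is an infinite weakly decreasing sequence of natural numbers with finitely many
  nonzero terms.  Rows and columns are indexed from 0, so that the part \<open>p i\<close> is
  what is traditionally written \<open>p\<^sub>i\<^sub>+\<^sub>1\<close>.
\<close>

definition partitions :: "(nat \<Rightarrow> nat) set" where
  "partitions = {p. antimono p \<and> finite {i. p i \<noteq> 0}}"

definition part_size :: "(nat \<Rightarrow> nat) \<Rightarrow> nat" where
  "part_size p = (\<Sum>i | p i \<noteq> 0. p i)"

definition conjugate :: "(nat \<Rightarrow> nat) \<Rightarrow> nat \<Rightarrow> nat" where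
  "conjugate p j = card {i. j < p i}"

definition diagram :: "(nat \<Rightarrow> nat) \<Rightarrow> (nat \<times> nat) set" where
  "diagram p = {(i, j). j < p i}"

text \<open>The extra \<open>- 1\<close> in arm and leg accounts for counting rows and columns from 0;
  on squares of the diagram the subtractions do not truncate.\<close>

definition arm :: "(nat \<Rightarrow> nat) \<Rightarrow> nat \<times> nat \<Rightarrow> nat" where
  "arm p = (\<lambda>(i, j). p i - j - 1)"

definition leg :: "(nat \<Rightarrow> nat) \<Rightarrow> nat \<times> nat \<Rightarrow> nat" where
  "leg p = (\<lambda>(i, j). conjugate p j - i - 1)"

definition hook :: "(nat \<Rightarrow> nat) \<Rightarrow> nat \<times> nat \<Rightarrow> nat" where
  "hook p s = arm p s + leg p s + 1"

definition hooks :: "nat \<Rightarrow> (nat \<Rightarrow> nat) \<Rightarrow> nat multiset" where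
  "hooks r p = {#h \<in># image_mset (hook p) (mset_set (diagram p)). r dvd h#}"

definition bottom_squares :: "(nat \<Rightarrow> nat) \<Rightarrow> (nat \<times> nat) set" where
  "bottom_squares p = {s \<in> diagram p. leg p s = 0}"

definition bottom_hooks :: "nat \<Rightarrow> (nat \<Rightarrow> nat) \<Rightarrow> nat multiset" where
  "bottom_hooks r p =
     {#h \<in># image_mset (hook p) (mset_set (bottom_squares p)). r dvd h#}"

text \<open>
  Infinite sums and products of formal power series are taken with respect to the standard
  \<open>fps_X\<close>-adic metric on \<^typ>\<open>'a fps\<close>.
\<close>

definition qpoch_inf :: "'a::comm_ring_1 fps \<Rightarrow> 'a fps \<Rightarrow> 'a fps" where
  "qpoch_inf a q = (\<Prod>j. 1 - a * q ^ j)"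

definition f_series :: "nat \<Rightarrow> (nat \<Rightarrow> 'a::comm_ring_1) \<Rightarrow> 'a fps" where
  "f_series r \<rho> =
     (\<Sum>\<^sub>\<infinity>p\<in>partitions. fps_X ^ part_size p * fps_const (\<Prod>h\<in>#bottom_hooks 1 p. \<rho> (r * h)))"

text \<open>
  Identities in the two formal variables $T$ and $S$ over a ring \<open>R\<close> live in $R[S][[T]]$,
  i.e. in \<^typ>\<open>'a poly fps\<close>.
\<close>

abbreviation T_var :: "'a::comm_ring_1 poly fps" where
  "T_var \<equiv> fps_X"

abbreviation S_var :: "'a::comm_ring_1 poly fps" where
  "S_var \<equiv> fps_const [:0, 1:]"

text \<open>The embedding of $R[[T]]$ into $R[S][[T]]$.\<close>

definition fps_lift_S :: "'a::comm_ring_1 fps \<Rightarrow> 'a poly fps" where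
  "fps_lift_S f = Abs_fps (\<lambda>n. [:fps_nth f n:])"

text \<open>
  The library's \<open>inverse\<close> on power series needs an \<open>inverse\<close> operation on
  coefficients, which a general commutative ring (or a polynomial ring) does not have.  Only
  denominators with constant coefficient 1 occur here, whose reciprocal is the following.
\<close>

definition fps_quot :: "'a::comm_ring_1 fps \<Rightarrow> 'a fps \<Rightarrow> 'a fps" where
  "fps_quot f g = f * fps_right_inverse g 1"

lemma fps_quot_iff:
  assumes "fps_nth g 0 = 1"
  shows "fps_quot f g = h \<longleftrightarrow> f = h * g"
proof -
  have inv: "g * fps_right_inverse g 1 = 1"
    using assms by (intro fps_right_inverse) simp
  then have inv': "fps_right_inverse g 1 * g = 1"
    by (simp add: mult.commute)
  show ?thesis
    unfolding fps_quot_def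
    by (metis inv inv' mult.assoc mult.right_neutral)
qed

end

theory Submission
  imports Defs
begin

text \<open>
  The bottom squares of a partition \<open>p\<close> lie at the right ends of its rows: row \<open>i\<close> has
  \<open>p i - p (i + 1)\<close> of them, with hook lengths \<open>1, 2, \<dots>, p i - p (i + 1)\<close>.  Hence the weight
  in \<open>\<rho>\<close> depends only on the quotients of these gaps by \<open>r\<close>.  Division of all gaps by \<open>r\<close>
  with remainder writes \<open>p\<close> uniquely as \<open>e + r n\<close>, taken part by part, where all gaps of \<open>e\<close>
  are smaller than \<open>r\<close>; and the weight of \<open>p\<close> for the modulus \<open>r\<close> is the weight of \<open>n\<close> in
  \<open>f_series\<close> (\<open>bij_betw_add_multiple\<close>, \<open>prod_bottom_hooks_add_multiple\<close>).

  The number of hooks divisible by \<open>r\<close> is compatible with this decomposition: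
  \<open>size (hooks r p) = size (hooks r e) + part_size n\<close>.  To see this, \<open>p\<close> is encoded by its Maya
  diagram, the set of integers \<open>p i - i - 1\<close> (the beads).  Hooks of length \<open>h\<close> are pairs of a bead
  \<open>b\<close> and a vacant position \<open>b - h\<close>, so the hooks divisible by \<open>r\<close> are found separately in the
  \<open>r\<close> residue classes.  Each class, rescaled, is again a Maya diagram, given by a partition
  and a charge.  Comparison of the sums of all beads shows that \<open>part_size p - r * size (hooks r p)\<close>
  depends on the charges only (\<open>part_size_hooks_same_charges\<close>), and adding \<open>r n\<close> moves every bead
  within its class, which changes no charge.

  Therefore the left-hand side is \<open>E \<cdot> f\<^sub>r(S T\<^sup>r)\<close>, where \<open>E\<close> counts the partitions with gaps
  smaller than \<open>r\<close> by size and by number of hooks divisible by \<open>r\<close> (\<open>bottom_hooks_gf\<close>), and \<open>E\<close> does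
  not depend on \<open>\<rho>\<close>.  It is found from the case \<open>\<rho> = 1\<close>.  The same Maya diagrams give
  Littlewood's bijection between partitions and pairs of an \<open>r\<close>-core, recorded by charges of sum 0,
  and \<open>r\<close> arbitrary partitions, so the sum for \<open>\<rho> = 1\<close> is \<open>C(T) P(S T\<^sup>r)\<^sup>r\<close>, where \<open>P\<close> is the
  generating function of all partitions and \<open>C\<close> that of the \<open>r\<close>-cores (\<open>hooks_gf\<close>).  Setting \<open>S = 1\<close>
  yields \<open>C(T) = P(T) / P(T\<^sup>r)\<^sup>r\<close> without any further knowledge of cores.  So
  \<open>E = C(T) P(S T\<^sup>r)\<^sup>r\<^sup>-\<^sup>1\<close>, and Euler's product for \<open>P\<close> (\<open>euler_product\<close>) turns this into the
  stated quotient (\<open>small_gaps_gf\<close>).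
\<close>

text \<open>The symbol \<open>$\<close> denotes coefficients of power series throughout, not components of vectors.\<close>

unbundle no vec_syntax

section \<open>Generating functions of weighted sets\<close>

text \<open>
  The sum of \<open>c x T\<^bsup>w x\<^esup>\<close> over \<open>x \<in> A\<close>, defined coefficient by coefficient, so that bijections and
  products can be handled without convergence.  It has this meaning only if all fibres of \<open>w\<close>
  are finite.
\<close>
definition gf :: "'x set \<Rightarrow> ('x \<Rightarrow> nat) \<Rightarrow> ('x \<Rightarrow> 'b::comm_ring_1) \<Rightarrow> 'b fps" where
  "gf A w c = Abs_fps (\<lambda>n. \<Sum>x | x \<in> A \<and> w x = n. c x)"

definition finite_fibres :: "'x set \<Rightarrow> ('x \<Rightarrow> nat) \<Rightarrow> bool" where
  "finite_fibres A w \<longleftrightarrow> (\<forall>n. finite {x \<in> A. w x = n})"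

lemma gf_nth: "gf A w c $ n = (\<Sum>x | x \<in> A \<and> w x = n. c x)"
  by (simp add: gf_def)

lemma finite_fibresD: "finite_fibres A w \<Longrightarrow> finite {x \<in> A. w x = n}"
  by (simp add: finite_fibres_def)

lemma finite_fibres_le:
  assumes "finite_fibres A w"
  shows "finite {x \<in> A. w x \<le> n}"
proof -
  have "{x \<in> A. w x \<le> n} = (\<Union>k\<le>n. {x \<in> A. w x = k})" by auto
  then show ?thesis using assms by (simp add: finite_fibresD)
qed

lemma finite_fibres_subset: "finite_fibres A w \<Longrightarrow> B \<subseteq> A \<Longrightarrow> finite_fibres B w"
  unfolding finite_fibres_def by (auto intro: finite_subset[rotated])

lemma finite_fibres_mult:
  assumes "finite_fibres A w" "r > 0"
  shows "finite_fibres A (\<lambda>x. r * w x)"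
  unfolding finite_fibres_def
proof
  fix n
  have "{x \<in> A. r * w x = n} \<subseteq> {x \<in> A. w x = n div r}" using assms(2) by auto
  then show "finite {x \<in> A. r * w x = n}"
    using finite_fibresD[OF assms(1)] finite_subset by blast
qed

lemma finite_fibres_reindex:
  assumes h: "bij_betw h A B" and w: "\<And>x. x \<in> A \<Longrightarrow> w' (h x) = w x" and f: "finite_fibres B w'"
  shows "finite_fibres A w"
  unfolding finite_fibres_def
proof
  fix n
  have "h ` {x \<in> A. w x = n} \<subseteq> {y \<in> B. w' y = n}"
    using h w by (auto simp: bij_betw_def)
  moreover have "inj_on h {x \<in> A. w x = n}"
    using h by (auto simp: bij_betw_def inj_on_def)
  ultimately show "finite {x \<in> A. w x = n}"
    using finite_fibresD[OF f] inj_on_finite by blast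
qed

lemma gf_reindex:
  assumes h: "bij_betw h A B" and w: "\<And>x. x \<in> A \<Longrightarrow> w' (h x) = w x" 
    and c: "\<And>x. x \<in> A \<Longrightarrow> c' (h x) = c x"
  shows "gf B w' c' = gf A w c"
proof (rule fps_ext)
  fix n
  have "bij_betw h {x \<in> A. w x = n} {y \<in> B. w' y = n}"
    using h w by (auto simp: bij_betw_def inj_on_def)
  from sum.reindex_bij_betw[OF this, of c']
  show "gf B w' c' $ n = gf A w c $ n" by (simp add: gf_nth c)
qed

lemma gf_times:
  assumes A: "finite_fibres A w" and B: "finite_fibres B v"
  shows "gf (A \<times> B) (\<lambda>(a, b). w a + v b) (\<lambda>(a, b). c a * d b) = gf A w c * gf B v d"
proof (rule fps_ext)
  fix n
  have "{x \<in> A \<times> B. (\<lambda>(a, b). w a + v b) x = n}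
      = (\<Union>i\<in>{0..n}. {a \<in> A. w a = i} \<times> {b \<in> B. v b = n - i})" by auto
  then have "gf (A \<times> B) (\<lambda>(a, b). w a + v b) (\<lambda>(a, b). c a * d b) $ n
     = (\<Sum>x\<in>(\<Union>i\<in>{0..n}. {a \<in> A. w a = i} \<times> {b \<in> B. v b = n - i}). case x of (a, b) \<Rightarrow> c a * d b)"
    by (simp add: gf_nth)
  also have "\<dots> = (\<Sum>i=0..n. \<Sum>x\<in>{a \<in> A. w a = i} \<times> {b \<in> B. v b = n - i}. case x of (a, b) \<Rightarrow> c a * d b)"
    by (rule sum.UNION_disjoint) (auto simp: finite_fibresD[OF A] finite_fibresD[OF B])
  also have "\<dots> = (\<Sum>i=0..n. gf A w c $ i * gf B v d $ (n - i))"
    by (simp add: gf_nth sum_product sum.cartesian_product)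
  finally show "gf (A \<times> B) (\<lambda>(a, b). w a + v b) (\<lambda>(a, b). c a * d b) $ n = (gf A w c * gf B v d) $ n"
    by (simp add: fps_mult_nth)
qed

lemma finite_fibres_times:
  assumes A: "finite_fibres A w" and B: "finite_fibres B v"
  shows "finite_fibres (A \<times> B) (\<lambda>(a, b). w a + v b)"
  unfolding finite_fibres_def
proof
  fix n
  have "{x \<in> A \<times> B. (\<lambda>(a, b). w a + v b) x = n} \<subseteq> {a \<in> A. w a \<le> n} \<times> {b \<in> B. v b \<le> n}" by auto
  then show "finite {x \<in> A \<times> B. (\<lambda>(a, b). w a + v b) x = n}"
    using finite_fibres_le[OF A] finite_fibres_le[OF B] by (meson finite_SigmaI finite_subset)
qed

lemma gf_Un:
  assumes "finite_fibres A w" "finite_fibres B w" "A \<inter> B = {}"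
  shows "gf (A \<union> B) w c = gf A w c + gf B w c"
proof (rule fps_ext)
  fix n
  have "{x \<in> A \<union> B. w x = n} = {x \<in> A. w x = n} \<union> {x \<in> B. w x = n}" by auto
  then show "gf (A \<union> B) w c $ n = (gf A w c + gf B w c) $ n"
    using sum.union_disjoint[OF finite_fibresD[OF assms(1)] finite_fibresD[OF assms(2)], of n n c] assms(3)
    by (auto simp only: gf_nth fps_add_nth)
qed

lemma bij_betw_PiE_Suc:
  "bij_betw (\<lambda>(f, a). f(n := a)) ((PiE {..<n} (\<lambda>_. A)) \<times> A) (PiE {..<Suc n} (\<lambda>_. A))"
proof (rule bij_betw_byWitness[where f' = "\<lambda>f. (restrict f {..<n}, f n)"])
  show "\<forall>x\<in>(PiE {..<n} (\<lambda>_. A)) \<times> A. (restrict (case x of (f, a) \<Rightarrow> f(n := a)) {..<n}, (case x of (f, a) \<Rightarrow> f(n := a)) n) = x"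
    by (auto simp: fun_eq_iff restrict_def PiE_def extensional_def)
  show "\<forall>f\<in>PiE {..<Suc n} (\<lambda>_. A). (case (restrict f {..<n}, f n) of (f, a) \<Rightarrow> f(n := a)) = f"
    by (auto simp: fun_eq_iff restrict_def PiE_def extensional_def)
qed (auto simp: PiE_def extensional_def Pi_def split: if_splits)

text \<open>
  The two statements are proved in one induction because the product formula \<open>gf_times\<close> needs
  finite fibres on the factor that has been built so far.
\<close>
lemma gf_PiE:
  assumes A: "finite_fibres A w"
  shows "finite_fibres (PiE {..<n} (\<lambda>_. A)) (\<lambda>f. \<Sum>i<n. w (f i)) \<and>
    gf (PiE {..<n} (\<lambda>_. A)) (\<lambda>f. \<Sum>i<n. w (f i)) (\<lambda>f. \<Prod>i<n. c (f i)) = gf A w c ^ n"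
proof (induction n)
  case 0
  show ?case by (auto simp: finite_fibres_def fps_eq_iff gf_nth Collect_conv_if)
next
  case (Suc n)
  let ?F = "PiE {..<n} (\<lambda>_. A)"
  let ?h = "\<lambda>(f, a). f(n := a)"
  have bij: "bij_betw ?h (?F \<times> A) (PiE {..<Suc n} (\<lambda>_. A))"
    by (rule bij_betw_PiE_Suc)
  have w: "(\<Sum>i<Suc n. w (?h x i)) = (\<lambda>(f, a). (\<Sum>i<n. w (f i)) + w a) x" for x
    by (cases x) auto
  have c: "(\<Prod>i<Suc n. c (?h x i)) = (\<lambda>(f, a). (\<Prod>i<n. c (f i)) * c a) x" for x
    by (cases x) auto
  let ?g = "inv_into (?F \<times> A) ?h"
  have bij': "bij_betw ?g (PiE {..<Suc n} (\<lambda>_. A)) (?F \<times> A)"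
    by (rule bij_betw_inv_into[OF bij])
  have "finite_fibres (PiE {..<Suc n} (\<lambda>_. A)) (\<lambda>f. \<Sum>i<Suc n. w (f i))"
    using finite_fibres_times[OF conjunct1[OF Suc.IH] A]
    by (rule finite_fibres_reindex[OF bij', rotated])
       (subst w[symmetric], simp only: bij_betw_inv_into_right[OF bij])
  moreover have "gf (PiE {..<Suc n} (\<lambda>_. A)) (\<lambda>f. \<Sum>i<Suc n. w (f i)) (\<lambda>f. \<Prod>i<Suc n. c (f i))
      = gf A w c ^ n * gf A w c"
    unfolding conjunct2[OF Suc.IH, symmetric] gf_times[OF conjunct1[OF Suc.IH] A, symmetric]
    by (rule gf_reindex[OF bij]) (rule w, rule c)
  ultimately show ?case by (simp add: mult.commute)
qed

lemma gf_shift: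
  "(fps_const a * fps_X ^ m) * gf A w c = gf A (\<lambda>x. m + w x) (\<lambda>x. a * c x)"
proof (rule fps_ext)
  fix n
  have "((fps_const a * fps_X ^ m) * gf A w c) $ n = a * (if n < m then 0 else gf A w c $ (n - m))"
    by (simp add: mult.assoc fps_X_power_mult_nth)
  also have "\<dots> = gf A (\<lambda>x. m + w x) (\<lambda>x. a * c x) $ n"
  proof (cases "n < m")
    case True
    then have "{x \<in> A. m + w x = n} = {}" by auto
    then show ?thesis using True by (simp add: gf_nth)
  next
    case False
    then have "{x \<in> A. m + w x = n} = {x \<in> A. w x = n - m}" by auto
    then show ?thesis using False by (simp add: gf_nth sum_distrib_left)
  qed
  finally show "((fps_const a * fps_X ^ m) * gf A w c) $ n = gf A (\<lambda>x. m + w x) (\<lambda>x. a * c x) $ n" .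
qed

text \<open>
  In the \<open>fps_X\<close>-adic topology, finite partial sums converge as soon as each coefficient is eventually
  constant, and the \<open>n\<close>-th coefficient is final once the finite fibre over \<open>n\<close> has been included.
\<close>
lemma infsum_eq_gf:
  assumes "finite_fibres A w"
  shows "(\<Sum>\<^sub>\<infinity>x\<in>A. fps_X ^ w x * fps_const (c x)) = gf A w c"
proof (rule infsumI)
  show "((\<lambda>x. fps_X ^ w x * fps_const (c x)) has_sum gf A w c) A"
    unfolding has_sum_def
  proof (rule tendsto_fpsI)
    fix n
    let ?X = "{x \<in> A. w x = n}"
    have "(\<Sum>x\<in>F. fps_X ^ w x * fps_const (c x)) $ n = gf A w c $ n"
      if "finite F" "?X \<subseteq> F" "F \<subseteq> A" for F
    proof -
      have "(\<Sum>x\<in>F. fps_X ^ w x * fps_const (c x)) $ n = (\<Sum>x\<in>F. if w x = n then c x else 0)"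
        by (auto simp: fps_sum_nth intro!: sum.cong)
      also have "\<dots> = (\<Sum>x\<in>?X. c x)"
        using that by (intro sum.mono_neutral_cong_right) auto
      finally show ?thesis by (simp add: gf_nth)
    qed
    then show "\<forall>\<^sub>F F in finite_subsets_at_top A. (\<Sum>x\<in>F. fps_X ^ w x * fps_const (c x)) $ n = gf A w c $ n"
      unfolding eventually_finite_subsets_at_top
      using finite_fibresD[OF assms] by (intro exI[of _ ?X]) auto
  qed
qed

lemma monomial_power: "(fps_const s * fps_X ^ r) ^ n = fps_const (s ^ n) * fps_X ^ (r * n)"
  for s :: "'b::comm_ring_1"
  by (simp add: power_mult_distrib power_mult)

text \<open>
  The \<open>i\<close>-th power of the monomial contributes only in degree \<open>r i\<close>, so substitution multiplies all
  weights by \<open>r\<close> and turns each weight into a power of \<open>s\<close>.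
\<close>
lemma gf_compose_monomial:
  fixes s :: "'b::comm_ring_1"
  assumes "r > 0"
  shows "fps_compose (gf A w c) (fps_const s * fps_X ^ r) = gf A (\<lambda>x. r * w x) (\<lambda>x. s ^ w x * c x)"
proof (rule fps_ext)
  fix n
  have "fps_compose (gf A w c) (fps_const s * fps_X ^ r) $ n
     = (\<Sum>i=0..n. if n = r * i then s ^ i * gf A w c $ i else 0)"
    by (auto simp: fps_compose_nth monomial_power mult.commute intro!: sum.cong)
  also have "\<dots> = gf A (\<lambda>x. r * w x) (\<lambda>x. s ^ w x * c x) $ n"
  proof (cases "r dvd n")
    case True
    then obtain m where m: "n = r * m" by blast
    have "m \<le> n" using assms m by simp
    have "(\<Sum>i=0..n. if n = r * i then s ^ i * gf A w c $ i else 0)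
        = (\<Sum>i=0..n. if i = m then s ^ i * gf A w c $ i else 0)"
      using assms m by (intro sum.cong) auto
    also have "\<dots> = s ^ m * gf A w c $ m" using \<open>m \<le> n\<close> by simp
    also have "\<dots> = gf A (\<lambda>x. r * w x) (\<lambda>x. s ^ w x * c x) $ n"
      using assms m by (auto simp: gf_nth sum_distrib_left intro!: sum.cong)
    finally show ?thesis .
  next
    case False
    then have "{x \<in> A. r * w x = n} = {}" and "\<And>i. n \<noteq> r * i" by auto
    then show ?thesis by (simp only: gf_nth) simp
  qed
  finally show "fps_compose (gf A w c) (fps_const s * fps_X ^ r) $ n
     = gf A (\<lambda>x. r * w x) (\<lambda>x. s ^ w x * c x) $ n" .
qed

section \<open>Partitions and Euler's product\<close>

lemma antimono_partition: "p \<in> partitions \<Longrightarrow> i \<le> j \<Longrightarrow> p j \<le> p i"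
  by (simp add: partitions_def antimono_def)

lemma partition_eventually_zero:
  assumes "p \<in> partitions"
  obtains L where "\<And>i. i \<ge> L \<Longrightarrow> p i = 0"
proof -
  have "finite {i. p i \<noteq> 0}" using assms by (simp add: partitions_def)
  then obtain L where "\<forall>i\<in>{i. p i \<noteq> 0}. i < L" 
    using finite_nat_set_iff_bounded by auto
  then show ?thesis using that by (metis (mono_tags) leD mem_Collect_eq)
qed

lemma support_subset:
  fixes p :: "nat \<Rightarrow> nat"
  assumes "\<And>i. i \<ge> L \<Longrightarrow> p i = 0"
  shows "{i. p i \<noteq> 0} \<subseteq> {..<L}"
proof
  fix i assume "i \<in> {i. p i \<noteq> 0}"
  then show "i \<in> {..<L}" using assms[of i] by (cases "i < L") (auto simp: not_less)
qed

lemma partitionsI: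
  assumes "\<And>i. p (Suc i) \<le> p i" "\<And>i. i \<ge> L \<Longrightarrow> p i = 0"
  shows "p \<in> partitions"
proof -
  have "antimono p" using assms(1) by (simp add: antimono_iff_le_Suc)
  moreover have "{i. p i \<noteq> 0} \<subseteq> {..<L}" by (rule support_subset) (rule assms(2))
  ultimately show ?thesis by (auto simp: partitions_def intro: finite_subset)
qed

lemma part_size_eq_sum:
  assumes "\<And>i. i \<ge> L \<Longrightarrow> p i = 0"
  shows "part_size p = (\<Sum>i<L. p i)"
  unfolding part_size_def
proof (rule sum.mono_neutral_left)
  show "{i. p i \<noteq> 0} \<subseteq> {..<L}" by (rule support_subset) (rule assms)
qed auto

text \<open>If the part with index \<open>i\<close> is nonzero, then so are the \<open>i + 1\<close> parts up to it, and each is at least 1.\<close>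
lemma less_part_size:
  assumes p: "p \<in> partitions" and i: "p i \<noteq> 0"
  shows "i < part_size p"
proof -
  obtain L where L: "\<And>i. i \<ge> L \<Longrightarrow> p i = 0" using partition_eventually_zero[OF p] by blast
  have "Suc i = (\<Sum>j\<le>i. 1)" by simp
  also have "\<dots> \<le> (\<Sum>j\<le>i. p j)"
    using antimono_partition[OF p] i by (intro sum_mono) (metis One_nat_def Suc_leI atMost_iff gr0I le_zero_eq)
  also have "\<dots> \<le> (\<Sum>j<L. p j)"
  proof (rule sum_mono2)
    have "i < L" using L[of i] i by (cases "i < L") auto
    then show "{..i} \<subseteq> {..<L}" by auto
  qed auto
  finally show ?thesis using part_size_eq_sum[OF L] by simp
qed

lemma part_le_part_size:
  assumes p: "p \<in> partitions"
  shows "p i \<le> part_size p"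
proof (cases "p i = 0")
  case False
  then show ?thesis unfolding part_size_def
    using p by (intro member_le_sum) (auto simp: partitions_def)
qed auto

lemma finite_fibres_part_size: "finite_fibres partitions part_size"
  unfolding finite_fibres_def
proof
  fix n
  have "{p \<in> partitions. part_size p = n}
      \<subseteq> {p. \<forall>i. (i \<in> {..<n} \<longrightarrow> p i \<in> {..n}) \<and> (i \<notin> {..<n} \<longrightarrow> p i = 0)}"
  proof (intro subsetI CollectI allI conjI impI)
    fix p i assume p: "p \<in> {p \<in> partitions. part_size p = n}"
    show "p i \<in> {..n}" using part_le_part_size[of p i] p by auto
    show "p i = 0" if "i \<notin> {..<n}" using less_part_size[of p i] p that by auto
  qed
  then show "finite {p \<in> partitions. part_size p = n}"
    using finite_set_of_finite_funs[of "{..<n}" "{..n}" 0] by (auto intro: finite_subset)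
qed

definition bounded_length :: "nat \<Rightarrow> (nat \<Rightarrow> nat) set" where
  "bounded_length N = {p \<in> partitions. p N = 0}"

lemma bounded_lengthD: "p \<in> bounded_length N \<Longrightarrow> i \<ge> N \<Longrightarrow> p i = 0"
  using antimono_partition[of p N i] by (auto simp: bounded_length_def)

lemma bounded_length_part_size: "p \<in> bounded_length N \<Longrightarrow> part_size p = (\<Sum>i<N. p i)"
  by (rule part_size_eq_sum) (rule bounded_lengthD)

text \<open>
  A partition with exactly \<open>N + 1\<close> nonzero parts is obtained from one with at most \<open>N + 1\<close> parts by
  adding a full first column.  This gives the recursion in the number of parts behind Euler's product.
\<close>
lemma bij_betw_add_column:
  "bij_betw (\<lambda>p i. if i \<le> N then Suc (p i) else 0) (bounded_length (Suc N))
     (bounded_length (Suc N) - bounded_length N)"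
proof (rule bij_betw_byWitness[where f' = "\<lambda>p i. p i - 1"])
  show "\<forall>p\<in>bounded_length (Suc N). (\<lambda>i. (if i \<le> N then Suc (p i) else 0) - 1) = p"
  proof
    fix p assume p: "p \<in> bounded_length (Suc N)"
    show "(\<lambda>i. (if i \<le> N then Suc (p i) else 0) - 1) = p"
      using bounded_lengthD[OF p] by (simp add: fun_eq_iff)
  qed
  show "\<forall>p\<in>bounded_length (Suc N) - bounded_length N. (\<lambda>i. if i \<le> N then Suc (p i - 1) else 0) = p"
  proof safe
    fix p assume p: "p \<in> bounded_length (Suc N)" and n: "p \<notin> bounded_length N"
    have part: "p \<in> partitions" using p by (simp add: bounded_length_def)
    have "p N > 0" using p n by (auto simp: bounded_length_def)
    then have "p i > 0" if "i \<le> N" for i 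
      using antimono_partition[OF part that] by simp
    moreover have "p i = 0" if "\<not> i \<le> N" for i
      using bounded_lengthD[OF p] that by simp
    ultimately show "(\<lambda>i. if i \<le> N then Suc (p i - 1) else 0) = p" by (auto simp: fun_eq_iff)
  qed
  have "(\<lambda>i. if i \<le> N then Suc (p i) else 0) \<in> bounded_length (Suc N) - bounded_length N"
    if p: "p \<in> partitions" for p
  proof -
    have "(\<lambda>i. if i \<le> N then Suc (p i) else 0) \<in> partitions"
      by (rule partitionsI[where L = "Suc N"]) (simp_all add: antimono_partition[OF p])
    then show ?thesis by (simp add: bounded_length_def)
  qed
  then show "(\<lambda>p i. if i \<le> N then Suc (p i) else 0) ` bounded_length (Suc N)
      \<subseteq> bounded_length (Suc N) - bounded_length N"
    using bounded_length_def by (intro image_subsetI) simp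
  have "(\<lambda>i. p i - 1) \<in> bounded_length (Suc N)" if p: "p \<in> bounded_length (Suc N)" for p
  proof -
    have "p \<in> partitions" using p by (simp add: bounded_length_def)
    then have "p (Suc i) \<le> p i" for i using antimono_partition[of p i "Suc i"] by simp
    then have "(\<lambda>i. p i - 1) \<in> partitions"
      by (intro partitionsI[where L = "Suc N"]) (simp_all add: diff_le_mono bounded_lengthD[OF p])
    then show ?thesis using bounded_lengthD[OF p, of "Suc N"] by (simp add: bounded_length_def)
  qed
  then show "(\<lambda>p i. p i - 1) ` (bounded_length (Suc N) - bounded_length N) \<subseteq> bounded_length (Suc N)"
    by blast
qed

text \<open>
  The coefficient ring may have zero divisors, so the uniqueness of the value does not come for free.
  It holds because the degenerate case in the definition of \<open>has_prod\<close> requires a zero factor,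
  while factors with constant coefficient 1 are nonzero.
\<close>
lemma prodinf_fps_eqI:
  fixes f :: "nat \<Rightarrow> 'b::comm_ring_1 fps"
  assumes f0: "\<And>j. f j $ 0 = 1"
    and lim: "\<And>n N. n \<le> N \<Longrightarrow> (\<Prod>j<N. f j) $ n = R $ n"
  shows "prodinf f = R"
proof -
  have R: "R \<noteq> 0" using lim[of 0 0] by (metis fps_one_nth fps_zero_nth lessThan_0 order_refl prod.empty zero_neq_one)
  have nz: "f j \<noteq> 0" for j using f0[of j] by auto
  have L: "(\<lambda>n. \<Prod>j\<le>n. f j) \<longlonglongrightarrow> R"
  proof (rule tendsto_fpsI)
    fix n
    have "(\<Prod>j\<le>N. f j) $ n = R $ n" if "n \<le> N" for N
      using lim[of n "Suc N"] that by (simp add: lessThan_Suc_atMost)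
    then show "\<forall>\<^sub>F N in sequentially. (\<Prod>j\<le>N. f j) $ n = R $ n"
      by (rule eventually_sequentiallyI)
  qed
  then have "f has_prod R" using R by (simp add: has_prod_def raw_has_prod_def)
  moreover have "p = R" if "f has_prod p" for p
  proof -
    have "(\<lambda>n. \<Prod>j\<le>n. f j) \<longlonglongrightarrow> p"
      using that nz by (simp add: has_prod_def raw_has_prod_def)
    then show ?thesis using L by (rule LIMSEQ_unique)
  qed
  ultimately show ?thesis unfolding prodinf_def by (rule the_equality)
qed

text \<open>
  Let \<open>B N\<close> be the generating function of the partitions with at most \<open>N\<close> parts.  Then
  \<open>B (N + 1) (1 - q\<^sup>N\<^sup>+\<^sup>1) = B N\<close>, so the \<open>N\<close>-th partial product is inverse to \<open>B N\<close>, and \<open>B N\<close> agrees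
  with the full series up to degree \<open>N\<close>.  The identity is stated for a monomial \<open>q\<close> since
  \<open>T\<close>, \<open>T\<^sup>r\<close> and \<open>S T\<^sup>r\<close> are all needed.
\<close>
lemma euler_product:
  fixes s :: "'b::comm_ring_1"
  assumes r: "r > 0"
  defines "q \<equiv> fps_const s * fps_X ^ r"
  shows "gf partitions (\<lambda>p. r * part_size p) (\<lambda>p. s ^ part_size p) * qpoch_inf q q = 1"
proof -
  let ?w = "\<lambda>p. r * part_size p" and ?c = "\<lambda>p. s ^ part_size p"
  define P where "P = gf partitions ?w ?c"
  define B where "B N = gf (bounded_length N) ?w ?c" for N
  define D where "D N = (\<Prod>j<N. 1 - q * q ^ j)" for N
  have ff: "finite_fibres A ?w" if "A \<subseteq> partitions" for A
    using finite_fibres_subset[OF finite_fibres_mult[OF finite_fibres_part_size r] that] .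
  have sub: "bounded_length N \<subseteq> partitions" for N by (auto simp: bounded_length_def)
  \<comment> \<open>split off the partitions with exactly \<open>N + 1\<close> nonzero parts\<close>
  have rec: "B (Suc N) = B N + q ^ Suc N * B (Suc N)" for N
  proof -
    let ?C = "bounded_length (Suc N) - bounded_length N"
    have "bounded_length N \<subseteq> bounded_length (Suc N)"
      using bounded_lengthD[of _ N "Suc N"] by (auto simp: bounded_length_def)
    then have "B (Suc N) = gf (bounded_length N \<union> ?C) ?w ?c"
      unfolding B_def by (simp add: Un_absorb1)
    also have "\<dots> = B N + gf ?C ?w ?c"
      unfolding B_def using sub by (intro gf_Un ff) auto
    also have "gf ?C ?w ?c = gf (bounded_length (Suc N)) (\<lambda>p. r * Suc N + r * part_size p) (\<lambda>p. s ^ Suc N * s ^ part_size p)"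
    proof (rule gf_reindex[OF bij_betw_add_column])
      fix p assume p: "p \<in> bounded_length (Suc N)"
      let ?p = "\<lambda>i. if i \<le> N then Suc (p i) else 0"
      have "part_size ?p = (\<Sum>i<Suc N. Suc (p i))"
        by (subst part_size_eq_sum[where L = "Suc N"]) (auto intro: sum.cong)
      also have "\<dots> = Suc N + part_size p"
        unfolding bounded_length_part_size[OF p] by (subst sum_Suc) simp
      finally have sz: "part_size ?p = Suc N + part_size p" .
      show "r * part_size ?p = r * Suc N + r * part_size p" unfolding sz by (rule distrib_left)
      show "s ^ part_size ?p = s ^ Suc N * s ^ part_size p" unfolding sz by (rule power_add)
    qed
    also have "\<dots> = q ^ Suc N * B (Suc N)"
      unfolding B_def q_def monomial_power gf_shift ..
    finally show ?thesis .
  qed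
  have BD: "B N * D N = 1" for N
  proof (induction N)
    case 0
    have "bounded_length 0 = {\<lambda>_. 0}"
      using bounded_lengthD[of _ 0] by (auto simp: bounded_length_def fun_eq_iff intro!: partitionsI)
    then show ?case by (auto simp: B_def D_def fps_eq_iff gf_nth part_size_def Collect_conv_if)
  next
    case (Suc N)
    have "B (Suc N) * (1 - q ^ Suc N) = B N"
      using rec[of N] by (simp add: algebra_simps)
    moreover have "D (Suc N) = (1 - q ^ Suc N) * D N" by (simp add: D_def mult.commute)
    ultimately show ?case using Suc by (metis mult.assoc)
  qed
  have PB: "P $ n = B N $ n" if "n \<le> N" for n N
  proof -
    have "p N = 0" if "p \<in> partitions" "r * part_size p = n" for p
    proof (rule ccontr)
      assume "p N \<noteq> 0"
      then have "N < part_size p" using less_part_size that by blast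
      also have "\<dots> \<le> r * part_size p" using r by simp
      finally show False using that \<open>n \<le> N\<close> by simp
    qed
    then have "{p \<in> partitions. r * part_size p = n} = {p \<in> bounded_length N. r * part_size p = n}"
      by (auto simp: bounded_length_def)
    then show ?thesis by (simp add: P_def B_def gf_nth)
  qed
  define R where "R = fps_right_inverse P 1"
  have "B 0 $ 0 = 1" using BD[of 0] by (simp add: D_def)
  then have PR: "P * R = 1"
    unfolding R_def using PB[of 0 0] by (intro fps_right_inverse) simp
  have Q: "qpoch_inf q q = R"
    unfolding qpoch_inf_def
  proof (rule prodinf_fps_eqI)
    show "(1 - q * q ^ j) $ 0 = 1" for j using r by (simp add: q_def)
    fix n N :: nat assume n: "n \<le> N"
    have "(P * D N) $ m = (B N * D N) $ m" if "m \<le> N" for m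
      unfolding fps_mult_nth using that by (intro sum.cong refl) (simp add: PB[of _ N])
    then have one: "(P * D N) $ m = 1 $ m" if "m \<le> N" for m using BD that by simp
    have "D N = D N * (P * R)" using PR by simp
    also have "\<dots> = (P * D N) * R" by (simp only: mult_ac)
    finally have "D N $ n = ((P * D N) * R) $ n" by simp
    also have "\<dots> = (\<Sum>i=0..n. (P * D N) $ i * R $ (n - i))" by (rule fps_mult_nth)
    also have "\<dots> = (\<Sum>i=0..n. 1 $ i * R $ (n - i))"
      using n by (intro sum.cong refl) (simp only: one atLeastAtMost_iff order_trans[of _ n N])
    also have "\<dots> = (1 * R) $ n" by (rule fps_mult_nth[symmetric])
    finally show "(\<Prod>j<N. 1 - q * q ^ j) $ n = R $ n" by (simp add: D_def)
  qed
  show ?thesis unfolding Q using PR unfolding P_def .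
qed

section \<open>Maya diagrams and hooks\<close>

lemma less_conjugate_iff:
  assumes p: "p \<in> partitions"
  shows "i < conjugate p j \<longleftrightarrow> j < p i"
proof -
  obtain L where "\<And>i. i \<ge> L \<Longrightarrow> p i = 0" using partition_eventually_zero[OF p] by blast
  then have ex: "p L \<le> j" by simp
  define m where "m = (LEAST m. p m \<le> j)"
  have m: "p m \<le> j" unfolding m_def using ex by (rule LeastI)
  have "j < p i \<longleftrightarrow> i < m" for i
  proof
    assume "j < p i"
    show "i < m"
    proof (rule ccontr)
      assume "\<not> i < m"
      then have "p i \<le> p m" using antimono_partition[OF p, of m i] by simp
      then show False using \<open>j < p i\<close> m by simp
    qed
  next
    assume "i < m"
    then show "j < p i" using not_less_Least[of i "\<lambda>m. p m \<le> j"] by (simp add: m_def)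
  qed
  then have "{i. j < p i} = {..<m}" by auto
  then show ?thesis using \<open>\<And>i. j < p i \<longleftrightarrow> i < m\<close> by (simp add: conjugate_def)
qed

text \<open>
  The boundary of a Young diagram, read as a two-sided infinite sequence of steps: the vertical steps
  are at the positions \<open>bead k p i\<close>, one for each row, and the horizontal ones at \<open>gap k p j\<close>, one for each
  column.  The charge \<open>k\<close> is an overall shift.
\<close>
definition bead :: "int \<Rightarrow> (nat \<Rightarrow> nat) \<Rightarrow> nat \<Rightarrow> int" where
  "bead k p i = int (p i) - int i - 1 + k"

definition gap :: "int \<Rightarrow> (nat \<Rightarrow> nat) \<Rightarrow> nat \<Rightarrow> int" where
  "gap k p j = int j - int (conjugate p j) + k"

definition maya :: "int \<Rightarrow> (nat \<Rightarrow> nat) \<Rightarrow> int set" where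
  "maya k p = range (bead k p)"

definition inversions :: "int set \<Rightarrow> (int \<times> int) set" where
  "inversions M = {(a, b). a \<notin> M \<and> b \<in> M \<and> a < b}"

lemma bead_strict_antimono:
  assumes "p \<in> partitions" "i < j"
  shows "bead k p j < bead k p i"
  using antimono_partition[OF assms(1), of i j] assms(2) by (simp add: bead_def)

lemma bead_eq_iff: "p \<in> partitions \<Longrightarrow> bead k p i = bead k p j \<longleftrightarrow> i = j"
  using bead_strict_antimono[of p i j k] bead_strict_antimono[of p j i k] by (cases i j rule: linorder_cases) auto

lemma gap_strict_mono:
  assumes p: "p \<in> partitions" and "i < j"
  shows "gap k p i < gap k p j"
proof -
  have "conjugate p j \<le> conjugate p i"
  proof (rule ccontr)
    assume "\<not> ?thesis"
    then have "j < p (conjugate p i)" using less_conjugate_iff[OF p, of "conjugate p i" j] by simp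
    then have "i < p (conjugate p i)" using assms by simp
    then show False using less_conjugate_iff[OF p, of "conjugate p i" i] by simp
  qed
  then show ?thesis using assms by (simp add: gap_def)
qed

lemma gap_eq_iff: "p \<in> partitions \<Longrightarrow> gap k p i = gap k p j \<longleftrightarrow> i = j"
  using gap_strict_mono[of p i j k] gap_strict_mono[of p j i k] by (cases i j rule: linorder_cases) auto

lemma gap_less_bead_iff:
  assumes p: "p \<in> partitions"
  shows "gap k p j < bead k p i \<longleftrightarrow> j < p i"
  using less_conjugate_iff[OF p, of i j] by (auto simp: gap_def bead_def)

lemma gap_neq_bead:
  assumes p: "p \<in> partitions"
  shows "gap k p j \<noteq> bead k p i"
  using less_conjugate_iff[OF p, of i j] by (auto simp: gap_def bead_def)

text \<open>
  Every step is either vertical or horizontal.  For a vacant position \<open>y\<close>, let \<open>m\<close> be the number of beads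
  above it; then \<open>m\<close> is the length of the column \<open>y + m - k\<close>.
\<close>
lemma range_gap:
  assumes p: "p \<in> partitions"
  shows "range (gap k p) = - maya k p"
proof
  show "range (gap k p) \<subseteq> - maya k p"
    using gap_neq_bead[OF p] by (auto simp: maya_def)
  show "- maya k p \<subseteq> range (gap k p)"
  proof
    fix y assume "y \<in> - maya k p"
    then have y: "bead k p i \<noteq> y" for i by (auto simp: maya_def)
    obtain L where L: "\<And>i. i \<ge> L \<Longrightarrow> p i = 0" using partition_eventually_zero[OF p] by blast
    have "bead k p (L + nat (k - y)) < y" using L[of "L + nat (k - y)"] by (simp add: bead_def)
    define m where "m = (LEAST i. bead k p i < y)"
    have m: "bead k p m < y"
      unfolding m_def using \<open>bead k p (L + nat (k - y)) < y\<close> by (rule LeastI)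
    have less: "bead k p i > y" if "i < m" for i
      using not_less_Least[of i "\<lambda>i. bead k p i < y"] that y[of i] by (simp add: m_def)
    define j where "j = nat (y + int m - k)"
    have j: "int j = y + int m - k" using m by (simp add: j_def bead_def)
    have lt: "i < m \<longleftrightarrow> j < p i" for i
    proof
      assume "i < m"
      show "j < p i"
      proof (cases m)
        case (Suc m')
        then have "j < p m'" using less[of m'] j by (simp add: bead_def)
        then show ?thesis using antimono_partition[OF p, of i m'] \<open>i < m\<close> Suc by simp
      qed (use \<open>i < m\<close> in simp)
    next
      assume "j < p i"
      show "i < m"
      proof (rule ccontr)
        assume "\<not> i < m"
        then have "p i \<le> p m" using antimono_partition[OF p, of m i] by simp
        then show False using \<open>j < p i\<close> m j by (simp add: bead_def)
      qed
    qed
    then have "{i. j < p i} = {..<m}" by auto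
    then have "conjugate p j = m" by (simp add: conjugate_def)
    then have "gap k p j = y" using j by (simp add: gap_def)
    then show "y \<in> range (gap k p)" by blast
  qed
qed

lemma hook_eq:
  assumes p: "p \<in> partitions" and s: "(i, j) \<in> diagram p"
  shows "int (hook p (i, j)) = bead k p i - gap k p j"
proof -
  have "j < p i" using s by (simp add: diagram_def)
  moreover from this have "i < conjugate p j" using less_conjugate_iff[OF p] by simp
  ultimately show ?thesis by (simp add: hook_def arm_def leg_def bead_def gap_def)
qed

text \<open>
  A square is determined by its row and its column, that is, by the two boundary steps at the ends of
  its hook, and the hook length is the distance of these steps.
\<close>
lemma bij_betw_diagram_inversions:
  assumes p: "p \<in> partitions"
  shows "bij_betw (\<lambda>(i, j). (gap k p j, bead k p i)) (diagram p) (inversions (maya k p))"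
proof (rule bij_betw_imageI)
  show "inj_on (\<lambda>(i, j). (gap k p j, bead k p i)) (diagram p)"
    by (auto simp: inj_on_def bead_eq_iff[OF p] gap_eq_iff[OF p])
  show "(\<lambda>(i, j). (gap k p j, bead k p i)) ` diagram p = inversions (maya k p)"
  proof
    show "(\<lambda>(i, j). (gap k p j, bead k p i)) ` diagram p \<subseteq> inversions (maya k p)"
      using gap_neq_bead[OF p] gap_less_bead_iff[OF p]
      by (auto simp: inversions_def maya_def diagram_def)
    show "inversions (maya k p) \<subseteq> (\<lambda>(i, j). (gap k p j, bead k p i)) ` diagram p"
    proof
      fix x assume "x \<in> inversions (maya k p)"
      then obtain a b where x: "x = (a, b)" "a \<notin> maya k p" "b \<in> maya k p" "a < b"
        by (auto simp: inversions_def)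
      have "a \<in> range (gap k p)" using x range_gap[OF p] by simp
      then obtain j where j: "a = gap k p j" by blast
      obtain i where i: "b = bead k p i" using x by (auto simp: maya_def)
      have "(i, j) \<in> diagram p" using x i j gap_less_bead_iff[OF p] by (simp add: diagram_def)
      then show "x \<in> (\<lambda>(i, j). (gap k p j, bead k p i)) ` diagram p"
        using x i j by (intro image_eqI[of _ _ "(i, j)"]) auto
    qed
  qed
qed

lemma diagram_Sigma:
  assumes "\<And>i. i \<ge> L \<Longrightarrow> p i = 0"
  shows "diagram p = Sigma {..<L} (\<lambda>i. {..<p i})"
proof -
  have "i < L" if "j < p i" for i j using assms[of i] that by (cases "i < L") auto
  then show ?thesis by (auto simp: diagram_def)
qed

lemma finite_diagram: "p \<in> partitions \<Longrightarrow> finite (diagram p)"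
  by (erule partition_eventually_zero) (subst diagram_Sigma, auto)

lemma card_diagram: "p \<in> partitions \<Longrightarrow> card (diagram p) = part_size p"
  by (erule partition_eventually_zero) (subst diagram_Sigma, assumption, subst part_size_eq_sum, auto)

lemma card_inversions_maya: "p \<in> partitions \<Longrightarrow> card (inversions (maya k p)) = part_size p"
  using bij_betw_same_card[OF bij_betw_diagram_inversions] card_diagram by metis

lemma finite_inversions_maya: "p \<in> partitions \<Longrightarrow> finite (inversions (maya k p))"
  using bij_betw_finite[OF bij_betw_diagram_inversions] finite_diagram by blast

lemma size_hooks:
  assumes p: "p \<in> partitions"
  shows "size (hooks r p) = card {x \<in> inversions (maya k p). int r dvd snd x - fst x}"
proof -
  have "size (hooks r p) = card {s \<in> diagram p. r dvd hook p s}"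
    unfolding hooks_def using finite_diagram[OF p] by (simp add: filter_mset_image_mset)
  also have "\<dots> = card {x \<in> inversions (maya k p). int r dvd snd x - fst x}"
  proof (rule bij_betw_same_card[where f = "\<lambda>(i, j). (gap k p j, bead k p i)"])
    have dvd: "(r dvd hook p (i, j)) = (int r dvd bead k p i - gap k p j)" if "(i, j) \<in> diagram p" for i j
      unfolding hook_eq[OF p that, of k, symmetric] by simp
    show "bij_betw (\<lambda>(i, j). (gap k p j, bead k p i)) {s \<in> diagram p. r dvd hook p s}
        {x \<in> inversions (maya k p). int r dvd snd x - fst x}"
      by (rule bij_betw_Collect[OF bij_betw_diagram_inversions[OF p]]) (auto simp: dvd)
  qed
  finally show ?thesis .
qed

text \<open>
  The row index of a bead can be read off from the set alone; hence the charge and the partition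
  are determined by the Maya diagram.
\<close>
lemma bead_rank:
  assumes p: "p \<in> partitions"
  shows "card {x \<in> maya k p. bead k p i < x} = i"
proof -
  have "bead k p i < bead k p j \<longleftrightarrow> j < i" for j
    using bead_strict_antimono[OF p, of i j k] bead_strict_antimono[OF p, of j i k]
    by (cases i j rule: linorder_cases) auto
  then have "{x \<in> maya k p. bead k p i < x} = bead k p ` {..<i}" by (auto simp: maya_def)
  then show ?thesis by (simp add: card_image inj_on_def bead_eq_iff[OF p])
qed

lemma maya_inject:
  assumes p: "p \<in> partitions" and p': "p' \<in> partitions" and eq: "maya k p = maya k' p'"
  shows "k = k' \<and> p = p'"
proof -
  have beads: "bead k p i = bead k' p' i" for i
  proof -
    have "bead k p i \<in> maya k' p'" unfolding eq[symmetric] by (simp add: maya_def)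
    then obtain j where j: "bead k p i = bead k' p' j" by (auto simp: maya_def)
    have "j = card {x \<in> maya k' p'. bead k' p' j < x}" by (rule bead_rank[OF p', symmetric])
    also have "\<dots> = i" unfolding eq[symmetric] j[symmetric] by (rule bead_rank[OF p])
    finally show ?thesis using j by simp
  qed
  obtain L L' where "\<And>i. i \<ge> L \<Longrightarrow> p i = 0" "\<And>i. i \<ge> L' \<Longrightarrow> p' i = 0"
    using partition_eventually_zero[OF p] partition_eventually_zero[OF p'] by metis
  then have "p (L + L') = 0" "p' (L + L') = 0" by simp_all
  then have k: "k = k'" using beads[of "L + L'"] by (simp add: bead_def)
  then have "p i = p' i" for i using beads[of i] by (simp add: bead_def)
  then show ?thesis using k by auto
qed

lemma eventually_notin_maya:
  assumes p: "p \<in> partitions"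
  shows "\<forall>\<^sub>F x in at_top. x \<notin> maya k p"
proof -
  have "x \<notin> maya k p" if "x \<ge> int (p 0) + k" for x
  proof
    assume "x \<in> maya k p"
    then obtain i where i: "x = bead k p i" by (auto simp: maya_def)
    have "p i \<le> p 0" by (rule antimono_partition[OF p]) simp
    then show False using i that by (simp add: bead_def)
  qed
  then show ?thesis unfolding eventually_at_top_linorder by blast
qed

lemma eventually_in_maya:
  assumes p: "p \<in> partitions"
  shows "\<forall>\<^sub>F x in at_bot. x \<in> maya k p"
proof -
  obtain L where L: "\<And>i. i \<ge> L \<Longrightarrow> p i = 0" using partition_eventually_zero[OF p] by blast
  have "x \<in> maya k p" if "x \<le> k - 1 - int L" for x
  proof -
    have "p (nat (k - 1 - x)) = 0" using that by (intro L) linarith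
    then have "x = bead k p (nat (k - 1 - x))" using that by (simp add: bead_def)
    then show ?thesis by (auto simp: maya_def)
  qed
  then show ?thesis unfolding eventually_at_bot_linorder by blast
qed

text \<open>
  The elements of \<open>M\<close> are listed in decreasing order as \<open>t - e 0, t - e 1, \<dots>\<close>, with \<open>e\<close> strictly
  increasing.  As \<open>M\<close> contains everything far below, \<open>e i - i\<close> is weakly increasing and eventually
  equal to a constant \<open>d\<close>; the parts are the differences \<open>d - (e i - i)\<close>.
\<close>
lemma maya_exists:
  assumes top: "\<forall>\<^sub>F x in at_top. x \<notin> M" and bot: "\<forall>\<^sub>F x in at_bot. x \<in> M"
  shows "\<exists>k. \<exists>p\<in>partitions. M = maya k p"
proof -
  obtain t where t: "\<And>x. x \<ge> t \<Longrightarrow> x \<notin> M" using top by (auto simp: eventually_at_top_linorder)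
  obtain u where u: "\<And>x. x \<le> u \<Longrightarrow> x \<in> M" using bot by (auto simp: eventually_at_bot_linorder)
  define A where "A = {n. t - int n \<in> M}"
  \<comment> \<open>from \<open>m\<close> on, \<open>A\<close> has no holes, so \<open>e\<close> increases by exactly 1\<close>
  define m where "m = nat (t - u)"
  have m: "n \<in> A" if "n \<ge> m" for n
    using u[of "t - int n"] that by (simp add: A_def m_def)
  have inf: "infinite A"
  proof
    assume "finite A"
    then obtain b where "\<forall>a\<in>A. a < b" using finite_nat_set_iff_bounded by auto
    then show False using m[of "m + b"] by auto
  qed
  define e where "e = enumerate A"
  have e: "e i < e (Suc i)" "i \<le> e i" for i
    using enumerate_step[OF inf] le_enumerate[OF inf] by (simp_all add: e_def)
  have range_e: "range e = A" unfolding e_def by (rule range_enumerate[OF inf])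
  have step: "e (Suc i) = Suc (e i)" if "i \<ge> m" for i
  proof -
    have "Suc (e i) \<in> A" using m[of "Suc (e i)"] e(2)[of i] that by simp
    then have "e (Suc i) \<le> Suc (e i)"
      unfolding e_def enumerate_Suc''[OF inf] by (intro Least_le) simp
    then show ?thesis using e(1)[of i] by simp
  qed
  define d where "d = e m - m"
  have tail: "e (m + i) = m + i + d" for i
  proof (induction i)
    case 0
    then show ?case using e(2)[of m] by (simp add: d_def)
  qed (use step in simp)
  have tail': "e i = i + d" if "i \<ge> m" for i using tail[of "i - m"] that by simp
  have mono: "e i + (j - i) \<le> e j" if "i \<le> j" for i j
    using that
  proof (induction j)
    case (Suc j)
    then show ?case using e(1)[of j] by (cases "i = Suc j") auto
  qed simp
  define p where "p i = d + i - e i" for i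
  have le: "e i \<le> d + i" for i using mono[of i "i + m"] tail'[of "i + m"] by simp
  have "p \<in> partitions"
  proof (rule partitionsI[where L = m])
    show "p (Suc i) \<le> p i" for i using e(1)[of i] by (simp add: p_def)
    show "p i = 0" if "m \<le> i" for i using tail'[OF that] by (simp add: p_def)
  qed
  moreover have "t - int (e i) = bead (t + 1 - int d) p i" for i
    using le[of i] by (simp add: bead_def p_def of_nat_diff)
  then have "maya (t + 1 - int d) p = (\<lambda>n. t - int n) ` range e"
    by (simp add: maya_def image_image)
  moreover have "(\<lambda>n. t - int n) ` A = M"
  proof
    show "M \<subseteq> (\<lambda>n. t - int n) ` A"
    proof
      fix x assume x: "x \<in> M"
      then have "x < t" using t[of x] by linarith
      then have "x = t - int (nat (t - x))" by simp
      then show "x \<in> (\<lambda>n. t - int n) ` A" using x unfolding A_def by (metis image_eqI mem_Collect_eq)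
    qed
  qed (auto simp: A_def)
  ultimately show ?thesis unfolding range_e by metis
qed

section \<open>Residue classes and charges\<close>

definition component :: "nat \<Rightarrow> int set \<Rightarrow> nat \<Rightarrow> int set" where
  "component r M c = {x. int r * x + int c \<in> M}"

text \<open>
  Two positions differ by a multiple of \<open>r\<close> if and only if they lie in the same class, and rescaling
  a class preserves its order.
\<close>
lemma card_inversions_dvd:
  assumes r: "r > 0" and fin: "\<And>c. c < r \<Longrightarrow> finite (inversions (component r M c))"
  shows "card {x \<in> inversions M. int r dvd snd x - fst x} = (\<Sum>c<r. card (inversions (component r M c)))"
proof -
  have "card (Sigma {..<r} (\<lambda>c. inversions (component r M c)))
      = card {x \<in> inversions M. int r dvd snd x - fst x}"
  proof (rule bij_betw_same_card[where f = "\<lambda>(c, a, b). (int r * a + int c, int r * b + int c)"])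
    show "bij_betw (\<lambda>(c, a, b). (int r * a + int c, int r * b + int c))
       (Sigma {..<r} (\<lambda>c. inversions (component r M c))) {x \<in> inversions M. int r dvd snd x - fst x}"
    proof (rule bij_betw_byWitness[where f' = "\<lambda>(a, b). (nat (a mod int r), a div int r, b div int r)"])
      show "\<forall>x\<in>{x \<in> inversions M. int r dvd snd x - fst x}.
        (\<lambda>(c, a, b). (int r * a + int c, int r * b + int c))
          ((\<lambda>(a, b). (nat (a mod int r), a div int r, b div int r)) x) = x"
      proof
        fix x assume "x \<in> {x \<in> inversions M. int r dvd snd x - fst x}"
        moreover obtain a b where x: "x = (a, b)" by (cases x)
        ultimately have eq: "a mod int r = b mod int r" by (simp add: mod_eq_dvd_iff dvd_diff_commute)
        have "int r * (a div int r) + int (nat (a mod int r)) = a" using r by simp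
        moreover have "int r * (b div int r) + int (nat (a mod int r)) = b" unfolding eq using r by simp
        ultimately show "(\<lambda>(c, a, b). (int r * a + int c, int r * b + int c))
          ((\<lambda>(a, b). (nat (a mod int r), a div int r, b div int r)) x) = x" by (simp add: x)
      qed
      show "(\<lambda>(a, b). (nat (a mod int r), a div int r, b div int r)) ` {x \<in> inversions M. int r dvd snd x - fst x}
         \<subseteq> Sigma {..<r} (\<lambda>c. inversions (component r M c))"
      proof (rule image_subsetI)
        fix x assume x: "x \<in> {x \<in> inversions M. int r dvd snd x - fst x}"
        obtain a b where ab: "x = (a, b)" by (cases x)
        then have eq: "a mod int r = b mod int r" using x by (simp add: mod_eq_dvd_iff dvd_diff_commute)
        have a: "int r * (a div int r) + int (nat (a mod int r)) = a" using r by simp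
        have b: "int r * (b div int r) + int (nat (a mod int r)) = b" unfolding eq using r by simp
        have "int r * (a div int r) < int r * (b div int r)"
          using a b ab x by (auto simp: inversions_def)
        then have "a div int r < b div int r" using r by simp
        moreover have "nat (a mod int r) < r" using r by (simp add: nat_less_iff)
        ultimately show "(\<lambda>(a, b). (nat (a mod int r), a div int r, b div int r)) x
            \<in> Sigma {..<r} (\<lambda>c. inversions (component r M c))"
          using ab x a b by (auto simp: inversions_def component_def)
      qed
    qed (use r in \<open>auto simp: inversions_def component_def\<close>)
  qed
  then show ?thesis using fin by (subst (asm) card_SigmaI) auto
qed

text \<open>
  The cut-off at a multiple of \<open>- r\<close> is what makes the truncations of the classes all start at the
  same point \<open>- N\<close>.
\<close>
lemma sum_component:
  fixes f :: "int \<Rightarrow> int"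
  assumes r: "r > 0" and fin: "\<And>c. c < r \<Longrightarrow> finite (component r M c \<inter> {- int N..})"
  shows "(\<Sum>b\<in>M \<inter> {- int (r * N)..}. f b)
    = (\<Sum>c<r. \<Sum>x\<in>component r M c \<inter> {- int N..}. f (int r * x + int c))"
proof -
  have bound: "- int (r * N) \<le> int r * x + int c \<longleftrightarrow> - int N \<le> x" if "c < r" for x c
  proof
    assume "- int N \<le> x"
    then have "int r * (- int N) \<le> int r * x" by (intro mult_left_mono) auto
    then show "- int (r * N) \<le> int r * x + int c" by simp
  next
    assume *: "- int (r * N) \<le> int r * x + int c"
    show "- int N \<le> x"
    proof (rule ccontr)
      assume "\<not> - int N \<le> x"
      then have "int r * x \<le> int r * (- int N - 1)" by (intro mult_left_mono) auto
      then show False using * that by (simp add: algebra_simps)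
    qed
  qed
  have "(\<Sum>c<r. \<Sum>x\<in>component r M c \<inter> {- int N..}. f (int r * x + int c))
     = (\<Sum>(c, x)\<in>Sigma {..<r} (\<lambda>c. component r M c \<inter> {- int N..}). f (int r * x + int c))"
    using fin by (subst sum.Sigma) auto
  also have "\<dots> = (\<Sum>b\<in>M \<inter> {- int (r * N)..}. f b)"
  proof (rule sum.reindex_bij_witness[where i = "\<lambda>b. (nat (b mod int r), b div int r)"
        and j = "\<lambda>(c, x). int r * x + int c"])
    fix b assume b: "b \<in> M \<inter> {- int (r * N)..}"
    have eq: "int r * (b div int r) + int (nat (b mod int r)) = b" using r by simp
    have c: "nat (b mod int r) < r" using r by (simp add: nat_less_iff)
    show "(nat (b mod int r), b div int r) \<in> Sigma {..<r} (\<lambda>c. component r M c \<inter> {- int N..})"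
      using b c eq bound[OF c, of "b div int r"] by (auto simp: component_def)
    show "(case (nat (b mod int r), b div int r) of (c, x) \<Rightarrow> int r * x + int c) = b"
      using eq by simp
  qed (use r bound in \<open>auto simp: component_def\<close>)
  finally show ?thesis by simp
qed

definition triangle :: "nat \<Rightarrow> int" where
  "triangle n = (\<Sum>i<n. int i)"

lemma maya_Int_atLeast:
  assumes "int L + k \<ge> 0" "\<And>i. int i \<ge> int L + k \<Longrightarrow> p i = 0"
  shows "maya k p \<inter> {- int L..} = bead k p ` {..<nat (int L + k)}"
proof -
  have "- int L \<le> bead k p i \<longleftrightarrow> i < nat (int L + k)" for i
  proof (cases "int i \<ge> int L + k")
    case True
    then show ?thesis using assms(2)[of i] by (simp add: bead_def)
  next
    case False
    then show ?thesis using assms(1) by (simp add: bead_def)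
  qed
  then show ?thesis by (auto simp: maya_def)
qed

lemma eventually_maya_Int_atLeast:
  assumes p: "p \<in> partitions"
  shows "\<forall>\<^sub>F L in sequentially. int L + k \<ge> 0 \<and>
    maya k p \<inter> {- int L..} = bead k p ` {..<nat (int L + k)} \<and> (\<forall>i\<ge>nat (int L + k). p i = 0)"
proof -
  obtain L0 where L0: "\<And>i. i \<ge> L0 \<Longrightarrow> p i = 0" using partition_eventually_zero[OF p] by blast
  show ?thesis
  proof (rule eventually_sequentiallyI)
    fix L assume "L0 + nat (- k) \<le> L"
    then have L: "int L + k \<ge> int L0" by linarith
    then have "p i = 0" if "int i \<ge> int L + k" for i using that by (intro L0) linarith
    with L show "int L + k \<ge> 0 \<and>
      maya k p \<inter> {- int L..} = bead k p ` {..<nat (int L + k)} \<and> (\<forall>i\<ge>nat (int L + k). p i = 0)"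
      by (intro conjI maya_Int_atLeast) auto
  qed
qed

lemma sum_maya_Int_atLeast:
  assumes p: "p \<in> partitions" and M: "maya k p \<inter> {- int L..} = bead k p ` {..<n}"
  shows "(\<Sum>b\<in>maya k p \<inter> {- int L..}. f b) = (\<Sum>i<n. f (bead k p i))"
  unfolding M by (subst sum.reindex) (auto simp: inj_on_def bead_eq_iff[OF p])

lemma eventually_bead_count:
  assumes p: "p \<in> partitions"
  shows "\<forall>\<^sub>F L in sequentially. finite (maya k p \<inter> {- int L..}) \<and>
     int (card (maya k p \<inter> {- int L..})) = int L + k"
  using eventually_maya_Int_atLeast[OF p, of k]
proof eventually_elim
  case (elim L)
  moreover have "card (bead k p ` {..<nat (int L + k)}) = nat (int L + k)"
    by (subst card_image) (auto simp: inj_on_def bead_eq_iff[OF p])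
  ultimately show ?case by simp
qed

text \<open>
  Maya diagrams are infinite, so their statistics are taken above a low cut-off \<open>- L\<close>, where the number of
  beads is \<open>L + k\<close> and their sum is the size of the partition up to a term that depends only on \<open>L\<close>
  and \<open>k\<close>.
\<close>
lemma eventually_bead_sum:
  assumes p: "p \<in> partitions"
  shows "\<forall>\<^sub>F L in sequentially.
     (\<Sum>b\<in>maya k p \<inter> {- int L..}. b + int L) = int (part_size p) + triangle (nat (int L + k))"
  using eventually_maya_Int_atLeast[OF p, of k]
proof eventually_elim
  case (elim L)
  define n where "n = nat (int L + k)"
  have n: "int n = int L + k" using elim by (simp add: n_def)
  have M: "maya k p \<inter> {- int L..} = bead k p ` {..<n}" using elim by (simp add: n_def)
  have zero: "p i = 0" if "i \<ge> n" for i using elim that by (simp add: n_def)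
  have "(\<Sum>b\<in>maya k p \<inter> {- int L..}. b + int L) = (\<Sum>i<n. bead k p i + int L)"
    by (rule sum_maya_Int_atLeast[OF p M])
  also have "\<dots> = (\<Sum>i<n. int (p i) + int (n - Suc i))"
    using n by (intro sum.cong) (auto simp: bead_def)
  also have "\<dots> = int (\<Sum>i<n. p i) + (\<Sum>i<n. int (n - Suc i))"
    by (simp add: sum.distrib)
  also have "(\<Sum>i<n. int (n - Suc i)) = triangle n"
    unfolding triangle_def by (rule sum.nat_diff_reindex)
  also have "(\<Sum>i<n. p i) = part_size p" using part_size_eq_sum[OF zero] by simp
  finally show ?case by (simp add: n_def)
qed

lemma eventually_dilated:
  assumes "r > 0" "\<forall>\<^sub>F L in sequentially. P L"
  shows "\<forall>\<^sub>F N in sequentially. P (r * N)"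
proof -
  obtain L where L: "\<And>n. n \<ge> L \<Longrightarrow> P n" using assms(2) by (auto simp: eventually_sequentially)
  have "P (r * N)" if "N \<ge> L" for N
  proof (rule L)
    have "L \<le> 1 * N" using that by simp
    also have "\<dots> \<le> r * N" using assms(1) by (intro mult_right_mono) auto
    finally show "L \<le> r * N" .
  qed
  then show ?thesis by (rule eventually_sequentiallyI)
qed

text \<open>
  Count the beads above \<open>- r N\<close>, and add up their heights over the cut-off, in two ways: for the whole
  diagram and for each class.  In the second identity everything apart from the sizes of the partitions
  is a function of \<open>N\<close> and the charges.
\<close>
lemma component_charges:
  assumes r: "r > 0" and p: "p \<in> partitions"
    and l: "\<And>c. c < r \<Longrightarrow> l c \<in> partitions"
    and comp: "\<And>c. c < r \<Longrightarrow> component r (maya j p) c = maya (k c) (l c)"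
  shows "j = (\<Sum>c<r. k c)"
    and "\<forall>\<^sub>F N in sequentially. int (part_size p) + triangle (nat (int (r * N) + j)) =
      int r * int (\<Sum>c<r. part_size (l c))
      + (\<Sum>c<r. int r * triangle (nat (int N + k c)) + int c * (int N + k c))"
proof -
  have A: "\<forall>\<^sub>F N in sequentially. finite (maya j p \<inter> {- int (r * N)..}) \<and>
     int (card (maya j p \<inter> {- int (r * N)..})) = int (r * N) + j"
    by (rule eventually_dilated[OF r eventually_bead_count[OF p]])
  have B: "\<forall>\<^sub>F N in sequentially.
     (\<Sum>b\<in>maya j p \<inter> {- int (r * N)..}. b + int (r * N)) = int (part_size p) + triangle (nat (int (r * N) + j))"
    by (rule eventually_dilated[OF r eventually_bead_sum[OF p]])
  have C: "\<forall>\<^sub>F N in sequentially. \<forall>c\<in>{..<r}. finite (maya (k c) (l c) \<inter> {- int N..}) \<and>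
     int (card (maya (k c) (l c) \<inter> {- int N..})) = int N + k c"
    by (intro eventually_ball_finite ballI eventually_bead_count l) auto
  have D: "\<forall>\<^sub>F N in sequentially. \<forall>c\<in>{..<r}. 
     (\<Sum>b\<in>maya (k c) (l c) \<inter> {- int N..}. b + int N) = int (part_size (l c)) + triangle (nat (int N + k c))"
    by (intro eventually_ball_finite ballI eventually_bead_sum l) auto
  have "\<forall>\<^sub>F N in sequentially. j = (\<Sum>c<r. k c)"
    using A C
  proof eventually_elim
    case (elim N)
    have "int (r * N) + j = (\<Sum>b\<in>maya j p \<inter> {- int (r * N)..}. 1)" using elim by simp
    also have "\<dots> = (\<Sum>c<r. \<Sum>x\<in>component r (maya j p) c \<inter> {- int N..}. 1)"
      by (rule sum_component[OF r]) (use elim comp in auto)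
    also have "\<dots> = (\<Sum>c<r. int N + k c)"
      using elim comp by (intro sum.cong) auto
    also have "\<dots> = int (r * N) + (\<Sum>c<r. k c)" by (simp add: sum.distrib)
    finally show ?case by simp
  qed
  then show "j = (\<Sum>c<r. k c)" by simp
  show "\<forall>\<^sub>F N in sequentially. int (part_size p) + triangle (nat (int (r * N) + j)) =
      int r * int (\<Sum>c<r. part_size (l c))
      + (\<Sum>c<r. int r * triangle (nat (int N + k c)) + int c * (int N + k c))"
    using B C D
  proof eventually_elim
    case (elim N)
    have "int (part_size p) + triangle (nat (int (r * N) + j))
        = (\<Sum>b\<in>maya j p \<inter> {- int (r * N)..}. b + int (r * N))" using elim by simp
    also have "\<dots> = (\<Sum>c<r. \<Sum>x\<in>component r (maya j p) c \<inter> {- int N..}. int r * x + int c + int (r * N))"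
      by (rule sum_component[OF r]) (use elim comp in auto)
    also have "\<dots> = (\<Sum>c<r. \<Sum>x\<in>maya (k c) (l c) \<inter> {- int N..}. int r * (x + int N) + int c)"
      using comp by (intro sum.cong) (auto simp: algebra_simps)
    also have "\<dots> = (\<Sum>c<r. int r * (int (part_size (l c)) + triangle (nat (int N + k c))) + int c * (int N + k c))"
    proof (intro sum.cong refl)
      fix c assume c: "c \<in> {..<r}"
      have "(\<Sum>x\<in>maya (k c) (l c) \<inter> {- int N..}. int r * (x + int N) + int c)
         = int r * (\<Sum>x\<in>maya (k c) (l c) \<inter> {- int N..}. x + int N)
           + int c * int (card (maya (k c) (l c) \<inter> {- int N..}))"
        by (subst sum.distrib) (simp only: sum_distrib_left sum_constant mult.commute)
      then show "(\<Sum>x\<in>maya (k c) (l c) \<inter> {- int N..}. int r * (x + int N) + int c)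
         = int r * (int (part_size (l c)) + triangle (nat (int N + k c))) + int c * (int N + k c)"
        using elim c by simp
    qed
    also have "\<dots> = int r * int (\<Sum>c<r. part_size (l c))
      + (\<Sum>c<r. int r * triangle (nat (int N + k c)) + int c * (int N + k c))"
      by (simp add: sum.distrib sum_distrib_left algebra_simps)
    finally show ?case .
  qed
qed

definition charge :: "int set \<Rightarrow> int" where
  "charge M = (SOME k. \<exists>p\<in>partitions. M = maya k p)"

definition shape :: "int set \<Rightarrow> nat \<Rightarrow> nat" where
  "shape M = (SOME p. p \<in> partitions \<and> M = maya (charge M) p)"

lemma charge_maya: "p \<in> partitions \<Longrightarrow> charge (maya k p) = k"
  unfolding charge_def using maya_inject by (intro some_equality) metis+

lemma shape_maya: "p \<in> partitions \<Longrightarrow> shape (maya k p) = p"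
  unfolding shape_def charge_maya using maya_inject by (intro some_equality) auto

lemma eventually_notin_component:
  assumes r: "r > 0" and M: "\<forall>\<^sub>F x in at_top. x \<notin> M"
  shows "\<forall>\<^sub>F x in at_top. x \<notin> component r M c"
proof -
  obtain t where t: "\<And>x. x \<ge> t \<Longrightarrow> x \<notin> M" using M by (auto simp: eventually_at_top_linorder)
  have "x \<notin> component r M c" if "x \<ge> max t 0" for x
  proof -
    have "1 * x \<le> int r * x" using r that by (intro mult_right_mono) auto
    then show ?thesis using t[of "int r * x + int c"] that by (simp add: component_def)
  qed
  then show ?thesis unfolding eventually_at_top_linorder by blast
qed

lemma eventually_in_component:
  assumes r: "r > 0" and M: "\<forall>\<^sub>F x in at_bot. x \<in> M"
  shows "\<forall>\<^sub>F x in at_bot. x \<in> component r M c"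
proof -
  obtain u where u: "\<And>x. x \<le> u \<Longrightarrow> x \<in> M" using M by (auto simp: eventually_at_bot_linorder)
  have "x \<in> component r M c" if "x \<le> min u 0 - int c" for x
  proof -
    have "int r * x \<le> 1 * x" using r that by (intro mult_right_mono_neg) auto
    then show ?thesis using u[of "int r * x + int c"] that by (simp add: component_def)
  qed
  then show ?thesis unfolding eventually_at_bot_linorder by blast
qed

lemma component_maya:
  assumes r: "r > 0" and p: "p \<in> partitions"
  shows "component r (maya j p) c = maya (charge (component r (maya j p) c)) (shape (component r (maya j p) c))"
    and "shape (component r (maya j p) c) \<in> partitions"
proof -
  obtain k q where "q \<in> partitions" "component r (maya j p) c = maya k q"
    using maya_exists[OF eventually_notin_component[OF r eventually_notin_maya[OF p]]
      eventually_in_component[OF r eventually_in_maya[OF p]]] by blast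
  then show "component r (maya j p) c = maya (charge (component r (maya j p) c)) (shape (component r (maya j p) c))"
    and "shape (component r (maya j p) c) \<in> partitions"
    by (simp_all add: charge_maya shape_maya)
qed

lemma component_inject:
  assumes r: "r > 0" and eq: "\<And>c. c < r \<Longrightarrow> component r M c = component r M' c"
  shows "M = M'"
proof -
  have "y \<in> X \<longleftrightarrow> y div int r \<in> component r X (nat (y mod int r))" for y X
    using r by (simp add: component_def)
  moreover have "nat (y mod int r) < r" for y using r by (simp add: nat_less_iff)
  ultimately show ?thesis using eq by (metis subsetI subset_antisym)
qed

definition glue :: "nat \<Rightarrow> (nat \<Rightarrow> int) \<Rightarrow> (nat \<Rightarrow> nat \<Rightarrow> nat) \<Rightarrow> int set" where
  "glue r k l = {y. y div int r \<in> maya (k (nat (y mod int r))) (l (nat (y mod int r)))}"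

lemma component_glue: "c < r \<Longrightarrow> component r (glue r k l) c = maya (k c) (l c)"
  by (simp add: component_def glue_def)

lemma glue_is_maya:
  assumes r: "r > 0" and l: "\<And>c. c < r \<Longrightarrow> l c \<in> partitions"
  shows "\<exists>j. \<exists>p\<in>partitions. glue r k l = maya j p"
proof (rule maya_exists)
  have res: "nat (y mod int r) < r" for y using r by (simp add: nat_less_iff)
  have "\<forall>\<^sub>F x in at_top. \<forall>c\<in>{..<r}. x \<notin> maya (k c) (l c)"
    by (intro eventually_ball_finite ballI eventually_notin_maya l) auto
  then obtain t where t: "\<And>x c. x \<ge> t \<Longrightarrow> c < r \<Longrightarrow> x \<notin> maya (k c) (l c)"
    unfolding eventually_at_top_linorder by (metis lessThan_iff)
  have "y \<notin> glue r k l" if "y \<ge> int r * t" for y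
    using zdiv_mono1[OF that, of "int r"] r t[of "y div int r", OF _ res] by (simp add: glue_def)
  then show "\<forall>\<^sub>F y in at_top. y \<notin> glue r k l" unfolding eventually_at_top_linorder by blast
  have "\<forall>\<^sub>F x in at_bot. \<forall>c\<in>{..<r}. x \<in> maya (k c) (l c)"
    by (intro eventually_ball_finite ballI eventually_in_maya l) auto
  then obtain u where u: "\<And>x c. x \<le> u \<Longrightarrow> c < r \<Longrightarrow> x \<in> maya (k c) (l c)"
    unfolding eventually_at_bot_linorder by (metis lessThan_iff)
  have "y \<in> glue r k l" if "y \<le> int r * u" for y
    using zdiv_mono1[OF that, of "int r"] r u[of "y div int r", OF _ res] by (simp add: glue_def)
  then show "\<forall>\<^sub>F y in at_bot. y \<in> glue r k l" unfolding eventually_at_bot_linorder by blast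
qed

text \<open>
  Both functions are restricted to the indices \<open>c < r\<close>, so that equality of the data of all classes
  is equality of functions.
\<close>
definition core_charges :: "nat \<Rightarrow> (nat \<Rightarrow> nat) \<Rightarrow> nat \<Rightarrow> int" where
  "core_charges r p = (\<lambda>c\<in>{..<r}. charge (component r (maya 0 p) c))"

definition quotient :: "nat \<Rightarrow> (nat \<Rightarrow> nat) \<Rightarrow> nat \<Rightarrow> nat \<Rightarrow> nat" where
  "quotient r p = (\<lambda>c\<in>{..<r}. shape (component r (maya 0 p) c))"

section \<open>Cores and quotients\<close>

text \<open>The charges of the classes add up to the charge of the whole, which is 0 for \<open>maya 0 p\<close>.\<close>
definition zero_sum :: "nat \<Rightarrow> (nat \<Rightarrow> int) set" where
  "zero_sum r = {k \<in> PiE {..<r} (\<lambda>_. UNIV). (\<Sum>c<r. k c) = 0}"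

lemma component_core_quotient:
  assumes "r > 0" "p \<in> partitions" "c < r"
  shows "component r (maya 0 p) c = maya (core_charges r p c) (quotient r p c)"
  using component_maya(1)[OF assms(1,2), of 0 c] assms(3) by (simp add: core_charges_def quotient_def)

lemma quotient_partitions: "r > 0 \<Longrightarrow> p \<in> partitions \<Longrightarrow> quotient r p \<in> PiE {..<r} (\<lambda>_. partitions)"
  by (auto simp: quotient_def component_maya(2))

lemma core_charges_zero_sum:
  assumes "r > 0" "p \<in> partitions"
  shows "core_charges r p \<in> zero_sum r"
proof -
  have "0 = (\<Sum>c<r. core_charges r p c)"
    using assms quotient_partitions[OF assms]
    by (intro component_charges(1)[OF assms, where l = "quotient r p"] component_core_quotient) auto
  then show ?thesis by (simp add: zero_sum_def core_charges_def)
qed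

text \<open>
  Littlewood's decomposition: a set of integers is determined by its residue classes, and
  any choice of Maya diagrams for the classes fits together to a Maya diagram, whose charge is 0 exactly if the
  charges have sum 0.
\<close>
lemma bij_betw_core_quotient:
  assumes r: "r > 0"
  shows "bij_betw (\<lambda>p. (core_charges r p, quotient r p)) partitions
     (zero_sum r \<times> PiE {..<r} (\<lambda>_. partitions))"
proof (rule bij_betw_imageI)
  show "inj_on (\<lambda>p. (core_charges r p, quotient r p)) partitions"
  proof (rule inj_onI)
    fix p q assume p: "p \<in> partitions" and q: "q \<in> partitions"
      and eq: "(core_charges r p, quotient r p) = (core_charges r q, quotient r q)"
    have "maya 0 p = maya 0 q"
      by (rule component_inject[OF r]) (use eq in \<open>simp add: component_core_quotient r p q\<close>)
    then show "p = q" using maya_inject[OF p q] by blast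
  qed
  show "(\<lambda>p. (core_charges r p, quotient r p)) ` partitions = zero_sum r \<times> PiE {..<r} (\<lambda>_. partitions)"
  proof
    show "(\<lambda>p. (core_charges r p, quotient r p)) ` partitions \<subseteq> zero_sum r \<times> PiE {..<r} (\<lambda>_. partitions)"
      using core_charges_zero_sum[OF r] quotient_partitions[OF r] by auto
    show "zero_sum r \<times> PiE {..<r} (\<lambda>_. partitions) \<subseteq> (\<lambda>p. (core_charges r p, quotient r p)) ` partitions"
    proof
      fix x assume "x \<in> zero_sum r \<times> PiE {..<r} (\<lambda>_. partitions)"
      then obtain k l where x: "x = (k, l)" and k: "k \<in> zero_sum r" and l: "l \<in> PiE {..<r} (\<lambda>_. partitions)"
        by auto
      have l': "l c \<in> partitions" if "c < r" for c using l that by auto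
      obtain j p where p: "p \<in> partitions" and j: "glue r k l = maya j p"
        using glue_is_maya[where l = l and k = k, OF r l'] by blast
      have comp: "component r (maya j p) c = maya (k c) (l c)" if "c < r" for c
        using component_glue[OF that, of k l] j by simp
      have "j = 0" using component_charges(1)[OF r p l' comp] k by (simp add: zero_sum_def)
      then have res: "charge (component r (maya 0 p) c) = k c" "shape (component r (maya 0 p) c) = l c"
        if "c < r" for c
        using comp[OF that] l'[OF that] by (simp_all add: charge_maya shape_maya)
      have "core_charges r p = k"
        by (rule extensionalityI[where A = "{..<r}"])
           (use k res in \<open>auto simp: zero_sum_def core_charges_def PiE_def\<close>)
      moreover have "quotient r p = l"
        by (rule extensionalityI[where A = "{..<r}"]) (use l res in \<open>auto simp: quotient_def PiE_def\<close>)
      ultimately show "x \<in> (\<lambda>p. (core_charges r p, quotient r p)) ` partitions"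
        using x p by (intro image_eqI[of _ _ p]) auto
    qed
  qed
qed

lemma size_hooks_quotient:
  assumes r: "r > 0" and p: "p \<in> partitions"
  shows "size (hooks r p) = (\<Sum>c<r. part_size (quotient r p c))"
proof -
  have q: "quotient r p c \<in> partitions" if "c < r" for c
    using quotient_partitions[OF r p] that by auto
  have "size (hooks r p) = (\<Sum>c<r. card (inversions (component r (maya 0 p) c)))"
    unfolding size_hooks[OF p, of r 0]
    by (rule card_inversions_dvd[OF r]) (simp add: component_core_quotient r p finite_inversions_maya q)
  also have "\<dots> = (\<Sum>c<r. part_size (quotient r p c))"
    by (intro sum.cong) (auto simp: component_core_quotient r p card_inversions_maya q)
  finally show ?thesis .
qed

text \<open>
  In other words, \<open>part_size p - r * size (hooks r p)\<close> depends only on the charges; it is the size of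
  the \<open>r\<close>-core of \<open>p\<close>.  The form without subtraction compares the two bead sums of \<open>component_charges\<close>
  at a common cut-off.
\<close>
lemma part_size_hooks_same_charges:
  assumes r: "r > 0" and p: "p \<in> partitions" and q: "q \<in> partitions"
    and eq: "core_charges r p = core_charges r q"
  shows "part_size p + r * size (hooks r q) = part_size q + r * size (hooks r p)"
proof -
  have *: "\<forall>\<^sub>F N in sequentially. int (part_size p) + triangle (nat (int (r * N) + 0)) =
      int r * int (size (hooks r p))
      + (\<Sum>c<r. int r * triangle (nat (int N + core_charges r p c)) + int c * (int N + core_charges r p c))"
    if p: "p \<in> partitions" for p
    unfolding size_hooks_quotient[OF r p]
    using r p quotient_partitions[OF r p] by (intro component_charges(2) component_core_quotient) auto
  have "\<forall>\<^sub>F N::nat in sequentially. int (part_size p) + int r * int (size (hooks r q)) = int (part_size q) + int r * int (size (hooks r p))"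
    using *[OF p] *[OF q] by eventually_elim (simp add: eq)
  then have "int (part_size p) + int r * int (size (hooks r q)) = int (part_size q) + int r * int (size (hooks r p))"
    by simp
  then have "int (part_size p + r * size (hooks r q)) = int (part_size q + r * size (hooks r p))"
    by simp
  then show ?thesis by (simp only: of_nat_eq_iff)
qed

definition empty_partition :: "nat \<Rightarrow> nat" where "empty_partition = (\<lambda>_. 0)"

text \<open>The partition with prescribed charges and empty quotient; it has no hooks divisible by \<open>r\<close>.\<close>
definition core :: "nat \<Rightarrow> (nat \<Rightarrow> int) \<Rightarrow> nat \<Rightarrow> nat" where
  "core r k = inv_into partitions (\<lambda>p. (core_charges r p, quotient r p)) (k, \<lambda>c\<in>{..<r}. empty_partition)"

lemma empty_partition_size: "empty_partition \<in> partitions" "part_size empty_partition = 0"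
  by (auto simp: empty_partition_def part_size_def intro!: partitionsI)

lemma core_properties:
  assumes r: "r > 0" and k: "k \<in> zero_sum r"
  shows "core r k \<in> partitions" "core_charges r (core r k) = k" "size (hooks r (core r k)) = 0"
proof -
  have x: "(k, \<lambda>c\<in>{..<r}. empty_partition) \<in> zero_sum r \<times> PiE {..<r} (\<lambda>_. partitions)"
    using k empty_partition_size by auto
  have eq: "(core_charges r (core r k), quotient r (core r k)) = (k, \<lambda>c\<in>{..<r}. empty_partition)"
    unfolding core_def by (rule bij_betw_inv_into_right[OF bij_betw_core_quotient[OF r] x])
  show p: "core r k \<in> partitions"
    unfolding core_def using bij_betw_core_quotient[OF r] x by (simp add: bij_betw_def inv_into_into)
  show "core_charges r (core r k) = k" using eq by simp
  show "size (hooks r (core r k)) = 0"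
    using eq by (simp add: size_hooks_quotient[OF r p] empty_partition_size)
qed

lemma part_size_core_quotient:
  assumes r: "r > 0" and p: "p \<in> partitions"
  shows "part_size p = part_size (core r (core_charges r p)) + r * size (hooks r p)"
proof -
  note c = core_properties[OF r core_charges_zero_sum[OF r p]]
  show ?thesis using part_size_hooks_same_charges[OF r p c(1) c(2)[symmetric]] c(3) by simp
qed

lemma finite_fibres_core:
  assumes r: "r > 0"
  shows "finite_fibres (zero_sum r) (\<lambda>k. part_size (core r k))"
proof (rule finite_fibres_reindex)
  show "bij_betw (core r) (zero_sum r) (core r ` zero_sum r)"
    by (rule inj_on_imp_bij_betw) (metis inj_onI core_properties(2)[OF r])
  show "finite_fibres (core r ` zero_sum r) part_size"
    using core_properties(1)[OF r] by (intro finite_fibres_subset[OF finite_fibres_part_size]) auto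
qed simp

definition core_gf :: "nat \<Rightarrow> 'b::comm_ring_1 fps" where
  "core_gf r = gf (zero_sum r) (\<lambda>k. part_size (core r k)) (\<lambda>_. 1)"

text \<open>
  The parameter \<open>s\<close> enters only through the quotient, not through the core.  This is why the case \<open>s = 1\<close>
  suffices to determine the factor \<open>core_gf r\<close>.
\<close>
lemma hooks_gf:
  fixes s :: "'b::comm_ring_1"
  assumes r: "r > 0"
  shows "gf partitions part_size (\<lambda>p. s ^ size (hooks r p))
    = core_gf r * gf partitions (\<lambda>p. r * part_size p) (\<lambda>p. s ^ part_size p) ^ r"
proof -
  let ?Q = "PiE {..<r} (\<lambda>_. partitions)"
  have "gf partitions part_size (\<lambda>p. s ^ size (hooks r p))
     = gf (zero_sum r \<times> ?Q) (\<lambda>(k, l). part_size (core r k) + (\<Sum>c<r. r * part_size (l c)))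
        (\<lambda>(k, l). 1 * (\<Prod>c<r. s ^ part_size (l c)))"
  proof (rule gf_reindex[OF bij_betw_core_quotient[OF r], symmetric])
    fix p assume p: "p \<in> partitions"
    show "(\<lambda>(k, l). part_size (core r k) + (\<Sum>c<r. r * part_size (l c))) (core_charges r p, quotient r p) = part_size p"
      using part_size_core_quotient[OF r p] by (simp add: size_hooks_quotient[OF r p] sum_distrib_left)
    show "(\<lambda>(k, l). 1 * (\<Prod>c<r. s ^ part_size (l c))) (core_charges r p, quotient r p) = s ^ size (hooks r p)"
      by (simp add: size_hooks_quotient[OF r p] power_sum)
  qed
  also have "\<dots> = core_gf r * gf partitions (\<lambda>p. r * part_size p) (\<lambda>p. s ^ part_size p) ^ r"
    using gf_PiE[OF finite_fibres_mult[OF finite_fibres_part_size r], of r "\<lambda>p. s ^ part_size p"]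
    by (simp only: gf_times[OF finite_fibres_core[OF r]] core_gf_def)
  finally show ?thesis .
qed

text \<open>
  The charge of a class is its number of beads above a low cut-off, corrected by the cut-off.
  Since row \<open>i\<close> contributes the bead \<open>p i - i - 1\<close>, this number can be found from the parts modulo \<open>r\<close>.
\<close>
lemma eventually_core_charges:
  assumes r: "r > 0" and p: "p \<in> partitions" and c: "c < r"
  shows "\<forall>\<^sub>F N in sequentially.
     int N + core_charges r p c = (\<Sum>i<r * N. if bead 0 p i mod int r = int c then 1 else 0)"
proof -
  have q: "quotient r p c \<in> partitions" if "c < r" for c
    using quotient_partitions[OF r p] that by auto
  have A: "\<forall>\<^sub>F N in sequentially. \<forall>c\<in>{..<r}. finite (component r (maya 0 p) c \<inter> {- int N..}) \<and>
     int (card (component r (maya 0 p) c \<inter> {- int N..})) = int N + core_charges r p c"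
    by (intro eventually_ball_finite ballI)
       (simp_all only: component_core_quotient r p lessThan_iff eventually_bead_count q finite_lessThan)
  have B: "\<forall>\<^sub>F N in sequentially. maya 0 p \<inter> {- int (r * N)..} = bead 0 p ` {..<nat (int (r * N) + 0)}"
    using eventually_dilated[OF r eventually_maya_Int_atLeast[OF p, of 0]] by (rule eventually_mono) blast
  show ?thesis using A B
  proof eventually_elim
    case (elim N)
    let ?f = "\<lambda>b. if b mod int r = int c then 1 else 0 :: int"
    have M: "maya 0 p \<inter> {- int (r * N)..} = bead 0 p ` {..<r * N}"
      using elim(2) by (simp only: add_0_right nat_int)
    have "(\<Sum>i<r * N. ?f (bead 0 p i)) = (\<Sum>b\<in>maya 0 p \<inter> {- int (r * N)..}. ?f b)"
      by (rule sum_maya_Int_atLeast[OF p M, symmetric])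
    also have "\<dots> = (\<Sum>d<r. \<Sum>x\<in>component r (maya 0 p) d \<inter> {- int N..}. ?f (int r * x + int d))"
      by (rule sum_component[OF r]) (use elim in auto)
    also have "\<dots> = (\<Sum>d<r. if d = c then int N + core_charges r p d else 0)"
      using elim by (intro sum.cong) auto
    also have "\<dots> = int N + core_charges r p c" using c by simp
    finally show ?case by simp
  qed
qed

lemma core_charges_cong:
  assumes r: "r > 0" and p: "p \<in> partitions" and q: "q \<in> partitions"
    and eq: "\<And>i. p i mod r = q i mod r"
  shows "core_charges r p = core_charges r q"
proof -
  have beads: "bead 0 p i mod int r = bead 0 q i mod int r" for i
  proof -
    have "int (p i) mod int r = int (q i) mod int r" using eq[of i] by (metis of_nat_mod)
    then have "(int (p i) - (int i + 1)) mod int r = (int (q i) - (int i + 1)) mod int r"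
      by (rule mod_diff_cong) simp
    then show ?thesis by (simp add: bead_def algebra_simps)
  qed
  have "core_charges r p c = core_charges r q c" if c: "c < r" for c
  proof -
    have "\<forall>\<^sub>F N::nat in sequentially. core_charges r p c = core_charges r q c"
      using eventually_core_charges[OF r p c] eventually_core_charges[OF r q c]
      by eventually_elim (simp add: beads)
    then show ?thesis by simp
  qed
  then show ?thesis
    by (intro extensionalityI[where A = "{..<r}"]) (simp_all add: core_charges_def)
qed

text \<open>Adding multiples of \<open>r\<close> to the parts keeps every bead in its class, hence does not change the charges.\<close>
lemma size_hooks_add_multiple:
  assumes r: "r > 0" and p: "p \<in> partitions" and q: "q \<in> partitions"
    and n: "n \<in> partitions" and eq: "\<And>i. q i = p i + r * n i"
  shows "part_size q = part_size p + r * part_size n"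
    and "size (hooks r q) = size (hooks r p) + part_size n"
proof -
  obtain L1 L2 where L1: "\<And>i. i \<ge> L1 \<Longrightarrow> p i = 0" and L2: "\<And>i. i \<ge> L2 \<Longrightarrow> n i = 0"
    using partition_eventually_zero[OF p] partition_eventually_zero[OF n] by metis
  define L where "L = L1 + L2"
  have "part_size q = (\<Sum>i<L. q i)" "part_size p = (\<Sum>i<L. p i)" "part_size n = (\<Sum>i<L. n i)"
    by (rule part_size_eq_sum, simp add: L_def eq L1 L2)+
  then show *: "part_size q = part_size p + r * part_size n"
    by (simp add: eq sum.distrib sum_distrib_left)
  have "core_charges r p = core_charges r q"
    by (rule core_charges_cong[OF r p q]) (simp add: eq)
  from part_size_hooks_same_charges[OF r p q this]
  have "r * size (hooks r q) = r * (size (hooks r p) + part_size n)"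
    unfolding * by (simp add: algebra_simps)
  then show "size (hooks r q) = size (hooks r p) + part_size n" using r by simp
qed

section \<open>Bottom hooks and division of the gaps\<close>

text \<open>The leg of a square is empty exactly if the next row does not reach its column.\<close>
lemma bottom_squares_Sigma:
  assumes p: "p \<in> partitions" and L: "\<And>i. i \<ge> L \<Longrightarrow> p i = 0"
  shows "bottom_squares p = Sigma {..<L} (\<lambda>i. {p (Suc i)..<p i})"
proof -
  have "leg p (i, j) = 0 \<longleftrightarrow> p (Suc i) \<le> j" for i j
    using less_conjugate_iff[OF p, of "Suc i" j] by (auto simp: leg_def)
  moreover have "i < L" if "j < p i" for i j using L[of i] that by (cases "i < L") auto
  ultimately show ?thesis by (auto simp: bottom_squares_def diagram_def)
qed

text \<open>
  Row \<open>i\<close> contributes the hook lengths \<open>1, \<dots>, p i - p (i + 1)\<close>, and the multiples of \<open>r\<close> among them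
  are \<open>r t\<close> for \<open>1 \<le> t \<le> (p i - p (i + 1)) div r\<close>.
\<close>
lemma prod_bottom_hooks:
  fixes g :: "nat \<Rightarrow> 'b::comm_monoid_mult"
  assumes r: "r > 0" and p: "p \<in> partitions" and L: "\<And>i. i \<ge> L \<Longrightarrow> p i = 0"
  shows "(\<Prod>h\<in>#bottom_hooks r p. g h) = (\<Prod>i<L. \<Prod>t=1..(p i - p (Suc i)) div r. g (r * t))"
proof -
  have S: "bottom_squares p = Sigma {..<L} (\<lambda>i. {p (Suc i)..<p i})"
    using p L by (rule bottom_squares_Sigma)
  have fin: "finite (bottom_squares p)" unfolding S by auto
  have hook: "hook p (i, j) = p i - j" if "(i, j) \<in> bottom_squares p" for i j
    using that by (auto simp: bottom_squares_def diagram_def hook_def arm_def)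
  have sq: "{s \<in> bottom_squares p. r dvd hook p s}
      = Sigma {..<L} (\<lambda>i. {j \<in> {p (Suc i)..<p i}. r dvd p i - j})"
    using hook unfolding S by auto
  have "(\<Prod>h\<in>#bottom_hooks r p. g h) = (\<Prod>s | s \<in> bottom_squares p \<and> r dvd hook p s. g (hook p s))"
    using fin by (simp add: bottom_hooks_def filter_mset_image_mset prod_unfold_prod_mset multiset.map_comp comp_def)
  also have "\<dots> = (\<Prod>(i, j)\<in>Sigma {..<L} (\<lambda>i. {j \<in> {p (Suc i)..<p i}. r dvd p i - j}). g (p i - j))"
    unfolding sq by (intro prod.cong) (auto simp: hook S)
  also have "\<dots> = (\<Prod>i<L. \<Prod>j | j \<in> {p (Suc i)..<p i} \<and> r dvd p i - j. g (p i - j))"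
    by (rule prod.Sigma[symmetric]) auto
  also have "\<dots> = (\<Prod>i<L. \<Prod>t=1..(p i - p (Suc i)) div r. g (r * t))"
  proof (rule prod.cong[OF refl])
    fix i
    have le: "p (Suc i) \<le> p i" by (rule antimono_partition[OF p]) simp
    show "(\<Prod>j | j \<in> {p (Suc i)..<p i} \<and> r dvd p i - j. g (p i - j))
      = (\<Prod>t=1..(p i - p (Suc i)) div r. g (r * t))"
    proof (rule prod.reindex_bij_witness[where i = "\<lambda>t. p i - r * t" and j = "\<lambda>j. (p i - j) div r"])
      fix t assume t: "t \<in> {1..(p i - p (Suc i)) div r}"
      then have "t * r \<le> p i - p (Suc i)" using r by (simp add: less_eq_div_iff_mult_less_eq)
      then have *: "r * t \<le> p i - p (Suc i)" by (simp add: mult.commute)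
      moreover have "r * t > 0" using r t by simp
      ultimately have "p (Suc i) \<le> p i - r * t" "p i - r * t < p i" "p i - (p i - r * t) = r * t"
        using le by linarith+
      then show "p i - r * t \<in> {j. j \<in> {p (Suc i)..<p i} \<and> r dvd p i - j}" by simp
      show "(p i - (p i - r * t)) div r = t" using * r le by simp
    next
      fix j assume j: "j \<in> {j. j \<in> {p (Suc i)..<p i} \<and> r dvd p i - j}"
      then have j': "p (Suc i) \<le> j" "j < p i" "r dvd p i - j" by auto
      show "p i - r * ((p i - j) div r) = j" using j' by simp
      show "g (r * ((p i - j) div r)) = g (p i - j)" using j' by simp
      have "(p i - j) div r \<ge> 1" using j' r by (simp add: dvd_imp_le Suc_le_eq div_greater_zero_iff)
      moreover have "(p i - j) div r \<le> (p i - p (Suc i)) div r" using j' by (intro div_le_mono) simp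
      ultimately show "(p i - j) div r \<in> {1..(p i - p (Suc i)) div r}" by simp
    qed
  qed
  finally show ?thesis .
qed

definition small_gaps :: "nat \<Rightarrow> (nat \<Rightarrow> nat) set" where
  "small_gaps r = {p \<in> partitions. \<forall>i. p i - p (Suc i) < r}"

lemma gap_add_multiple:
  assumes r: "r > 0" and e: "e \<in> small_gaps r" and n: "n \<in> partitions"
  shows "((e i + r * n i) - (e (Suc i) + r * n (Suc i))) div r = n i - n (Suc i)"
proof -
  have "e \<in> partitions" using e by (simp add: small_gaps_def)
  then have le: "e (Suc i) \<le> e i" "n (Suc i) \<le> n i"
    using antimono_partition[of e i "Suc i"] antimono_partition[OF n, of i "Suc i"] by auto
  then have "r * n (Suc i) \<le> r * n i" by (intro mult_left_mono) auto
  then have "(e i + r * n i) - (e (Suc i) + r * n (Suc i)) = (e i - e (Suc i)) + r * (n i - n (Suc i))"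
    using le by (simp add: diff_mult_distrib2)
  also have "\<dots> div r = n i - n (Suc i)" using e r by (simp add: small_gaps_def)
  finally show ?thesis .
qed

lemma partition_eqI:
  assumes p: "p \<in> partitions" and q: "q \<in> partitions" 
    and gaps: "\<And>i. p i - p (Suc i) = q i - q (Suc i)"
  shows "p = q"
proof
  fix i
  obtain L L' where L: "\<And>i. i \<ge> L \<Longrightarrow> p i = 0" "\<And>i. i \<ge> L' \<Longrightarrow> q i = 0"
    using partition_eventually_zero[OF p] partition_eventually_zero[OF q] by metis
  show "p i = q i"
  proof (cases "i \<le> L + L'")
    case True
    then show ?thesis
    proof (induction rule: inc_induct)
      case base
      then show ?case using L by simp
    next
      case (step m)
      then show ?case using gaps[of m] antimono_partition[OF p, of m "Suc m"]
        antimono_partition[OF q, of m "Suc m"] by simp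
    qed
  qed (use L in simp)
qed

lemma add_multiple_partition:
  assumes p: "p \<in> partitions" and n: "n \<in> partitions"
  shows "(\<lambda>i. p i + r * n i) \<in> partitions"
proof -
  obtain L L' where L: "\<And>i. i \<ge> L \<Longrightarrow> p i = 0" "\<And>i. i \<ge> L' \<Longrightarrow> n i = 0"
    using partition_eventually_zero[OF p] partition_eventually_zero[OF n] by metis
  show ?thesis
  proof (rule partitionsI[where L = "L + L'"])
    show "p (Suc i) + r * n (Suc i) \<le> p i + r * n i" for i
      using antimono_partition[OF p, of i "Suc i"] antimono_partition[OF n, of i "Suc i"]
      by (intro add_mono mult_left_mono) auto
  qed (use L in simp)
qed

lemma tail_sum_partition:
  fixes d :: "nat \<Rightarrow> nat"
  assumes "\<And>i. i \<ge> L \<Longrightarrow> d i = 0"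
  shows "(\<lambda>i. \<Sum>j=i..<L. d j) \<in> partitions"
    and "(\<Sum>j=i..<L. d j) - (\<Sum>j=Suc i..<L. d j) = d i"
proof -
  have *: "(\<Sum>j=i..<L. d j) = d i + (\<Sum>j=Suc i..<L. d j)" for i
    using assms[of i] by (cases "i < L") (auto simp: sum.atLeast_Suc_lessThan)
  show "(\<Sum>j=i..<L. d j) - (\<Sum>j=Suc i..<L. d j) = d i" using *[of i] by linarith
  show "(\<lambda>i. \<Sum>j=i..<L. d j) \<in> partitions"
  proof (rule partitionsI[where L = L])
    show "(\<Sum>j=Suc i..<L. d j) \<le> (\<Sum>j=i..<L. d j)" for i using *[of i] by linarith
  qed simp
qed

text \<open>
  A partition is determined by its gaps \<open>p i - p (i + 1)\<close>, which form an arbitrary finitely supported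
  sequence, and division of each gap by \<open>r\<close> with remainder is unique.
\<close>
lemma bij_betw_add_multiple:
  assumes r: "r > 0"
  shows "bij_betw (\<lambda>(e, n) i. e i + r * n i) (small_gaps r \<times> partitions) partitions"
proof (rule bij_betw_imageI)
  show "inj_on (\<lambda>(e, n) i. e i + r * n i) (small_gaps r \<times> partitions)"
  proof (rule inj_onI)
    fix x y assume "x \<in> small_gaps r \<times> partitions" "y \<in> small_gaps r \<times> partitions"
      and eq: "(\<lambda>(e, n) i. e i + r * n i) x = (\<lambda>(e, n) i. e i + r * n i) y"
    then obtain e n e' n' where x: "x = (e, n)" "e \<in> small_gaps r" "n \<in> partitions"
      and y: "y = (e', n')" "e' \<in> small_gaps r" "n' \<in> partitions" by (cases x, cases y) auto
    have eq': "e i + r * n i = e' i + r * n' i" for i using fun_cong[OF eq, of i] x y by simp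
    have "n = n'"
    proof (rule partition_eqI)
      show "n i - n (Suc i) = n' i - n' (Suc i)" for i
        using gap_add_multiple[OF r x(2,3), of i] gap_add_multiple[OF r y(2,3), of i] by (simp add: eq')
    qed (use x y in auto)
    moreover from this have "e = e'" using eq' by auto
    ultimately show "x = y" using x y by simp
  qed
  show "(\<lambda>(e, n) i. e i + r * n i) ` (small_gaps r \<times> partitions) = partitions"
  proof
    show "(\<lambda>(e, n) i. e i + r * n i) ` (small_gaps r \<times> partitions) \<subseteq> partitions"
      using add_multiple_partition by (auto simp: small_gaps_def)
    show "partitions \<subseteq> (\<lambda>(e, n) i. e i + r * n i) ` (small_gaps r \<times> partitions)"
    proof
      fix q assume q: "q \<in> partitions"
      obtain L where L: "\<And>i. i \<ge> L \<Longrightarrow> q i = 0" using partition_eventually_zero[OF q] by blast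
      define d where "d i = q i - q (Suc i)" for i
      define e where "e i = (\<Sum>j=i..<L. d j mod r)" for i
      define n where "n i = (\<Sum>j=i..<L. d j div r)" for i
      have d: "d i = 0" if "i \<ge> L" for i using L that by (simp add: d_def)
      have n: "n \<in> partitions"
        unfolding n_def by (rule tail_sum_partition) (simp add: d)
      have "e \<in> partitions"
        unfolding e_def by (rule tail_sum_partition) (simp add: d)
      moreover have "e i - e (Suc i) = d i mod r" for i
        unfolding e_def by (rule tail_sum_partition) (simp add: d)
      ultimately have e: "e \<in> small_gaps r" using r by (simp add: small_gaps_def)
      have "q = (\<lambda>i. \<Sum>j=i..<L. d j)"
      proof (rule partition_eqI[OF q])
        show "(\<lambda>i. \<Sum>j=i..<L. d j) \<in> partitions" by (rule tail_sum_partition) (rule d)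
        show "q i - q (Suc i) = (\<Sum>j=i..<L. d j) - (\<Sum>j=Suc i..<L. d j)" for i
          by (subst tail_sum_partition(2)) (simp_all add: d, simp add: d_def)
      qed
      also have "\<dots> = (\<lambda>i. e i + r * n i)"
        by (simp add: e_def n_def sum_distrib_left flip: sum.distrib)
      finally show "q \<in> (\<lambda>(e, n) i. e i + r * n i) ` (small_gaps r \<times> partitions)"
        using e n by (intro image_eqI[of _ _ "(e, n)"]) auto
    qed
  qed
qed

lemma prod_bottom_hooks_add_multiple:
  fixes g :: "nat \<Rightarrow> 'b::comm_monoid_mult"
  assumes r: "r > 0" and e: "e \<in> small_gaps r" and n: "n \<in> partitions"
  shows "(\<Prod>h\<in>#bottom_hooks r (\<lambda>i. e i + r * n i). g h) = (\<Prod>h\<in>#bottom_hooks 1 n. g (r * h))"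
proof -
  have q: "(\<lambda>i. e i + r * n i) \<in> partitions"
    using add_multiple_partition n e by (simp add: small_gaps_def)
  obtain L L' where L: "\<And>i. i \<ge> L \<Longrightarrow> e i + r * n i = 0" "\<And>i. i \<ge> L' \<Longrightarrow> n i = 0"
    using partition_eventually_zero[OF q] partition_eventually_zero[OF n] by metis
  have "(\<Prod>h\<in>#bottom_hooks r (\<lambda>i. e i + r * n i). g h)
     = (\<Prod>i<L + L'. \<Prod>t=1..(n i - n (Suc i)). g (r * t))"
    using prod_bottom_hooks[OF r q, of "L + L'" g] L by (simp add: gap_add_multiple[OF r e n])
  also have "\<dots> = (\<Prod>h\<in>#bottom_hooks 1 n. g (r * h))"
    using prod_bottom_hooks[OF _ n, of 1 "L + L'" "\<lambda>h. g (r * h)"] L by simp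
  finally show ?thesis .
qed

text \<open>The first factor on the right is free of \<open>g\<close>, so it can be determined from the constant function \<open>g = 1\<close>.\<close>
lemma bottom_hooks_gf:
  fixes s :: "'b::comm_ring_1"
  assumes r: "r > 0"
  shows "gf partitions part_size (\<lambda>p. s ^ size (hooks r p) * (\<Prod>h\<in>#bottom_hooks r p. g h))
    = gf (small_gaps r) part_size (\<lambda>p. s ^ size (hooks r p))
      * gf partitions (\<lambda>p. r * part_size p) (\<lambda>p. s ^ part_size p * (\<Prod>h\<in>#bottom_hooks 1 p. g (r * h)))"
proof -
  have sub: "small_gaps r \<subseteq> partitions" by (auto simp: small_gaps_def)
  show ?thesis
    unfolding gf_times[OF finite_fibres_subset[OF finite_fibres_part_size sub]
      finite_fibres_mult[OF finite_fibres_part_size r], symmetric]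
  proof (rule gf_reindex[OF bij_betw_add_multiple[OF r]])
    fix x assume "x \<in> small_gaps r \<times> partitions"
    then obtain e n where x: "x = (e, n)" and e: "e \<in> small_gaps r" and n: "n \<in> partitions" by auto
    have e': "e \<in> partitions" using e sub by auto
    note add = size_hooks_add_multiple[OF r e' add_multiple_partition[OF e' n] n refl]
    show "part_size ((\<lambda>(e, n) i. e i + r * n i) x) = (\<lambda>(e, n). part_size e + r * part_size n) x"
      by (simp add: x add)
    show "s ^ size (hooks r ((\<lambda>(e, n) i. e i + r * n i) x)) * (\<Prod>h\<in>#bottom_hooks r ((\<lambda>(e, n) i. e i + r * n i) x). g h)
       = (\<lambda>(e, n). s ^ size (hooks r e) * (s ^ part_size n * (\<Prod>h\<in>#bottom_hooks 1 n. g (r * h)))) x"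
      by (simp add: x add power_add prod_bottom_hooks_add_multiple[OF r e n] mult.assoc)
  qed
qed

section \<open>The identity\<close>

lemma prod_mset_fps_const: "(\<Prod>h\<in>#M. fps_const (f h)) = fps_const (\<Prod>h\<in>#M. f h)"
  for f :: "'x \<Rightarrow> 'b::comm_ring_1"
  by (induction M) auto

lemma prod_mset_const_poly: "(\<Prod>h\<in>#M. [:f h:]) = [:\<Prod>h\<in>#M. f h:]"
  for f :: "'x \<Rightarrow> 'b::comm_ring_1"
  by (induction M) (auto simp: one_pCons)

lemma sum_const_poly: "(\<Sum>x\<in>A. [:f x:]) = [:\<Sum>x\<in>A. f x:]"
  for f :: "'x \<Rightarrow> 'b::comm_ring_1"
  by (induction A rule: infinite_finite_induct) auto

lemma fps_lift_S_f_series: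
  "fps_lift_S (f_series r \<rho>) = gf partitions part_size (\<lambda>p. \<Prod>h\<in>#bottom_hooks 1 p. [:\<rho> (r * h):])"
  unfolding f_series_def infsum_eq_gf[OF finite_fibres_part_size]
  by (rule fps_ext) (simp add: fps_lift_S_def gf_nth prod_mset_const_poly sum_const_poly)

lemma gf_partitions_nth_0:
  fixes s :: "'b::comm_ring_1"
  assumes "r > 0"
  shows "gf partitions (\<lambda>p. r * part_size p) (\<lambda>p. s ^ part_size p) $ 0 = 1"
proof -
  have "p = empty_partition" if "p \<in> partitions" "part_size p = 0" for p
    using part_le_part_size[OF that(1)] that(2) by (auto simp: empty_partition_def)
  then have "{p \<in> partitions. r * part_size p = 0} = {empty_partition}"
    using assms empty_partition_size by auto
  then show ?thesis by (simp add: gf_nth empty_partition_size)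
qed

lemma qpoch_inf_nth_0:
  fixes s :: "'b::comm_ring_1"
  assumes r: "r > 0"
  shows "qpoch_inf (fps_const s * fps_X ^ r) (fps_const s * fps_X ^ r) $ 0 = 1"
  using arg_cong[OF euler_product[OF r, of s], of "\<lambda>f. f $ 0"]
  by (simp add: gf_partitions_nth_0[OF r])

text \<open>
  Write \<open>E\<close> for the left-hand side, \<open>P r s\<close> for the generating function of partitions at \<open>s T\<^sup>r\<close>
  and \<open>C\<close> for \<open>core_gf r\<close>.  The sum with trivial weight is \<open>E \<cdot> P r s\<close> by \<open>bottom_hooks_gf\<close> and
  \<open>C \<cdot> (P r s)\<^sup>r\<close> by \<open>hooks_gf\<close>; the latter with \<open>s = 1\<close> reads \<open>P 1 1 = C \<cdot> (P r 1)\<^sup>r\<close>.  Since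
  each \<open>P\<close> is inverse to a product, these equations can be solved for \<open>E\<close>.
\<close>
lemma small_gaps_gf:
  fixes s :: "'b::comm_ring_1"
  assumes r: "r > 0"
  defines "q \<equiv> fps_const s * fps_X ^ r"
  shows "gf (small_gaps r) part_size (\<lambda>p. s ^ size (hooks r p))
    = fps_quot (qpoch_inf (fps_X ^ r) (fps_X ^ r) ^ r) (qpoch_inf fps_X fps_X * qpoch_inf q q ^ (r - 1))"
proof -
  let ?E = "gf (small_gaps r) part_size (\<lambda>p. s ^ size (hooks r p))"
  let ?P = "\<lambda>r s. gf partitions (\<lambda>p. r * part_size p) (\<lambda>p. s ^ part_size p) :: 'b fps"
  let ?qX = "qpoch_inf fps_X fps_X :: 'b fps" and ?qr = "qpoch_inf (fps_X ^ r) (fps_X ^ r) :: 'b fps"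
  have X: "?P 1 1 * ?qX = 1" using euler_product[of 1 "1 :: 'b"] by simp
  have R: "?P r 1 * ?qr = 1" using euler_product[OF r, of "1 :: 'b"] by simp
  have Q: "?P r s * qpoch_inf q q = 1" unfolding q_def by (rule euler_product[OF r])
  have E: "?E * ?P r s = core_gf r * ?P r s ^ r"
    using bottom_hooks_gf[OF r, of s "\<lambda>_. 1"] hooks_gf[OF r, of s] by simp
  have C: "?P 1 1 = core_gf r * ?P r 1 ^ r" using hooks_gf[OF r, of "1 :: 'b"] by simp
  have pow: "qpoch_inf q q * qpoch_inf q q ^ (r - 1) = qpoch_inf q q ^ r"
    using r by (simp add: power_eq_if)
  \<comment> \<open>\<open>S = 1\<close> determines the generating function of the cores\<close>
  have core: "core_gf r = ?P 1 1 * ?qr ^ r"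
  proof -
    have "core_gf r = core_gf r * (?P r 1 * ?qr) ^ r" unfolding R by simp
    also have "\<dots> = (core_gf r * ?P r 1 ^ r) * ?qr ^ r" by (simp only: power_mult_distrib mult.assoc)
    finally show ?thesis unfolding C[symmetric] .
  qed
  have "?E * (?qX * qpoch_inf q q ^ (r - 1)) = (?E * (?P r s * qpoch_inf q q)) * (?qX * qpoch_inf q q ^ (r - 1))"
    unfolding Q by simp
  also have "\<dots> = (?E * ?P r s) * ?qX * (qpoch_inf q q * qpoch_inf q q ^ (r - 1))" by (simp only: mult_ac)
  also have "\<dots> = core_gf r * ?qX * (?P r s * qpoch_inf q q) ^ r"
    unfolding E pow power_mult_distrib by (simp only: mult_ac)
  also have "\<dots> = ?P 1 1 * ?qr ^ r * ?qX" unfolding Q core by simp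
  also have "\<dots> = (?P 1 1 * ?qX) * ?qr ^ r" by (simp only: mult_ac)
  also have "\<dots> = ?qr ^ r" unfolding X by simp
  finally have main: "?qr ^ r = ?E * (?qX * qpoch_inf q q ^ (r - 1))" by simp
  have "(?qX * qpoch_inf q q ^ (r - 1)) $ 0 = 1"
    using qpoch_inf_nth_0[of 1 "1 :: 'b"] qpoch_inf_nth_0[OF r, of s]
    by (simp add: q_def fps_nth_power_0)
  then show ?thesis using main by (simp only: fps_quot_iff[THEN iffD2])
qed

theorem theorem6p1:
  fixes r :: nat and \<rho> :: "nat \<Rightarrow> 'a::comm_ring_1"
  assumes "r > 0"
  shows "(\<Sum>\<^sub>\<infinity>p\<in>partitions. T_var ^ part_size p * S_var ^ size (hooks r p)
              * (\<Prod>h\<in>#bottom_hooks r p. fps_const [:\<rho> h:]))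
         = fps_quot (qpoch_inf (T_var ^ r) (T_var ^ r) ^ r)
             (qpoch_inf T_var T_var * qpoch_inf (S_var * T_var ^ r) (S_var * T_var ^ r) ^ (r - 1))
           * fps_compose (fps_lift_S (f_series r \<rho>)) (S_var * T_var ^ r)"
proof -
  let ?s = "[:0, 1:] :: 'a poly"
  have "(\<Sum>\<^sub>\<infinity>p\<in>partitions. T_var ^ part_size p * S_var ^ size (hooks r p)
              * (\<Prod>h\<in>#bottom_hooks r p. fps_const [:\<rho> h:]))
     = (\<Sum>\<^sub>\<infinity>p\<in>partitions. fps_X ^ part_size p
          * fps_const (?s ^ size (hooks r p) * (\<Prod>h\<in>#bottom_hooks r p. [:\<rho> h:])))"
    by (simp only: prod_mset_fps_const fps_const_power fps_const_mult mult.assoc)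
  also have "\<dots> = gf partitions part_size (\<lambda>p. ?s ^ size (hooks r p) * (\<Prod>h\<in>#bottom_hooks r p. [:\<rho> h:]))"
    by (rule infsum_eq_gf[OF finite_fibres_part_size])
  also have "\<dots> = gf (small_gaps r) part_size (\<lambda>p. ?s ^ size (hooks r p))
      * fps_compose (fps_lift_S (f_series r \<rho>)) (S_var * T_var ^ r)"
    unfolding bottom_hooks_gf[OF assms] fps_lift_S_f_series gf_compose_monomial[OF assms] ..
  finally show ?thesis unfolding small_gaps_gf[OF assms] .
qed

end
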